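(* Let $T$ be a rooted tree, $v \in V(T)$, and $p = p(v)$ (with $p=\emptyset$ if $v$ is the root). The procedure $\textsc{Claw-Deletion-Set}(T,v,p)$ described below returns a minimum claw-deletion set $S$ of $T_v^+$ such that: if $\mathrm{cdn}(T_v^+) = 1 + \mathrm{cdn}(T_v)$ then $p \in S$; and if $\mathrm{cdn}(T_v^+) = \mathrm{cdn}(T_v)$ and $\mathrm{cdn}(T_v) = 1 + \mathrm{cdn}(T_v \setminus \{v\})$ then $v \in S$. Consequently, given a forest $F$ and a positive integer $k$, the problem of deciding whether $F$ can be transformed into a linear forest by deleting at most $k$ vertices can be solved in linear time.
   Context: All graphs are finite, simple and undirected. A claw is $K_{1,3}$; a graph is claw-free if it has no induced $K_{1,3}$. A set $S\subseteq V(G)$ is a claw-deletion set of $G$ if $G\setminus S$ (the subgraph induced by $V(G)\setminus S$) is claw-free, and $\mathrm{cdn}(G)$ denotes the minimum cardinality of a claw-deletion set of $G$. A linear forest is a disjoint union of induced paths (equivalently, a claw-free forest). For a rooted tree $T$ and $v\in V(T)$: $T_v$ is the subtree rooted at $v$, $C(v)$ is the set of children of $v$, $p(v)$ is the parent of $v$ (for the root $r$, $p(r)=\emptyset$), $T_v^+$ is the subgraph of $T$ induced by $V(T_v)\cup\{p(v)\}$, and $T_r^+ = T$. Procedure $\textsc{Claw-Deletion-Set}(T,v,p)$: if $C(v)=\emptyset$, return $\emptyset$. Otherwise, set $S:=\emptyset$; for each $u \in C(v)$, set $S := S \cup \textsc{Claw-Deletion-Set}(T,u,v)$; let $c := |C(v)\setminus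 S|$; if $c \geq 3$, set $S := S\cup\{v\}$; else if $c = 2$ and $p \neq \emptyset$ and $v \notin S$, set $S := S \cup \{p\}$; return $S$. *)

theory Defs
  imports Main "HOL-Library.Disjoint_Sets"
begin

record 'a graph =
  verts :: "'a set"
  edges :: "'a set set"

definition simple_graph :: "'a graph \<Rightarrow> bool" where
  "simple_graph G \<longleftrightarrow> finite (verts G) \<and> (\<forall>e\<in>edges G. e \<subseteq> verts G \<and> card e = 2)"

definition induced :: "'a graph \<Rightarrow> 'a set \<Rightarrow> 'a graph" where
  "induced G X = \<lparr>verts = verts G \<inter> X, edges = {e \<in> edges G. e \<subseteq> X}\<rparr>"

definition delete_verts :: "'a graph \<Rightarrow> 'a set \<Rightarrow> 'a graph" where
  "delete_verts G S = induced G (verts G - S)"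

definition graph_iso :: "'a graph \<Rightarrow> 'b graph \<Rightarrow> bool" where
  "graph_iso G H \<longleftrightarrow> (\<exists>f. bij_betw f (verts G) (verts H) \<and> edges H = (\<lambda>e. f ` e) ` edges G)"


section \<open>Claw deletion\<close>

definition claw :: "nat graph" where
  "claw = \<lparr>verts = {0, 1, 2, 3}, edges = {{0, 1}, {0, 2}, {0, 3}}\<rparr>"

definition claw_free :: "'a graph \<Rightarrow> bool" where
  "claw_free G \<longleftrightarrow> \<not> (\<exists>X\<subseteq>verts G. graph_iso (induced G X) claw)"

definition claw_deletion_set :: "'a graph \<Rightarrow> 'a set \<Rightarrow> bool" where
  "claw_deletion_set G S \<longleftrightarrow> S \<subseteq> verts G \<and> claw_free (delete_verts G S)"

definition cdn :: "'a graph \<Rightarrow> nat" where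
  "cdn G = (LEAST k. \<exists>S. claw_deletion_set G S \<and> card S = k)"

definition min_claw_deletion_set :: "'a graph \<Rightarrow> 'a set \<Rightarrow> bool" where
  "min_claw_deletion_set G S \<longleftrightarrow> claw_deletion_set G S \<and> card S = cdn G"


section \<open>Forests and rooted trees\<close>

definition path :: "'a graph \<Rightarrow> 'a list \<Rightarrow> bool" where
  "path G xs \<longleftrightarrow> xs \<noteq> [] \<and> distinct xs \<and> set xs \<subseteq> verts G \<and>
     successively (\<lambda>x y. {x, y} \<in> edges G) xs"

definition path_between :: "'a graph \<Rightarrow> 'a \<Rightarrow> 'a \<Rightarrow> 'a list \<Rightarrow> bool" where
  "path_between G u v xs \<longleftrightarrow> path G xs \<and> hd xs = u \<and> last xs = v"

definition cycle :: "'a graph \<Rightarrow> 'a list \<Rightarrow> bool" where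
  "cycle G xs \<longleftrightarrow> path G xs \<and> 3 \<le> length xs \<and> {last xs, hd xs} \<in> edges G"

definition connected :: "'a graph \<Rightarrow> bool" where
  "connected G \<longleftrightarrow> verts G \<noteq> {} \<and> (\<forall>u\<in>verts G. \<forall>v\<in>verts G. \<exists>xs. path_between G u v xs)"

definition forest :: "'a graph \<Rightarrow> bool" where
  "forest G \<longleftrightarrow> simple_graph G \<and> (\<nexists>xs. cycle G xs)"

definition tree :: "'a graph \<Rightarrow> bool" where
  "tree G \<longleftrightarrow> forest G \<and> connected G"

definition path_graph :: "'a graph \<Rightarrow> bool" where
  "path_graph G \<longleftrightarrow> (\<exists>xs. xs \<noteq> [] \<and> distinct xs \<and> verts G = set xs \<and>
     edges G = {{xs ! i, xs ! Suc i} | i. Suc i < length xs})"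

definition linear_forest :: "'a graph \<Rightarrow> bool" where
  "linear_forest G \<longleftrightarrow> (\<exists>\<P>. partition_on (verts G) \<P> \<and>
     (\<forall>P\<in>\<P>. path_graph (induced G P)) \<and> (\<forall>e\<in>edges G. \<exists>P\<in>\<P>. e \<subseteq> P))"

definition rooted_tree :: "'a graph \<Rightarrow> 'a \<Rightarrow> bool" where
  "rooted_tree T r \<longleftrightarrow> tree T \<and> r \<in> verts T"

text \<open>In a tree there is exactly one path from the root to a given vertex; \<^term>\<open>a\<close> is a
  (not necessarily proper) ancestor of \<^term>\<open>w\<close> iff it lies on that path.\<close>

definition ancestor :: "'a graph \<Rightarrow> 'a \<Rightarrow> 'a \<Rightarrow> 'a \<Rightarrow> bool" where
  "ancestor T r a w \<longleftrightarrow> (\<forall>xs. path_between T r w xs \<longrightarrow> a \<in> set xs)"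

definition children :: "'a graph \<Rightarrow> 'a \<Rightarrow> 'a \<Rightarrow> 'a set" where
  "children T r v = {u \<in> verts T. {v, u} \<in> edges T \<and> ancestor T r v u}"

definition parent :: "'a graph \<Rightarrow> 'a \<Rightarrow> 'a \<Rightarrow> 'a option" where
  "parent T r v = (if v = r then None else Some (THE u. v \<in> children T r u))"

definition subtree_verts :: "'a graph \<Rightarrow> 'a \<Rightarrow> 'a \<Rightarrow> 'a set" where
  "subtree_verts T r v = {w \<in> verts T. ancestor T r v w}"

definition subtree :: "'a graph \<Rightarrow> 'a \<Rightarrow> 'a \<Rightarrow> 'a graph" where
  "subtree T r v = induced T (subtree_verts T r v)"

definition subtree_plus :: "'a graph \<Rightarrow> 'a \<Rightarrow> 'a \<Rightarrow> 'a graph" where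
  "subtree_plus T r v = induced T (subtree_verts T r v \<union> set_option (parent T r v))"


section \<open>The procedure\<close>

lemma path_between_prefix:
  assumes "path_between T r w xs" "u \<in> set xs"
  obtains ys zs where "xs = ys @ u # zs" "path_between T r u (ys @ [u])"
proof -
  obtain ys zs where xs: "xs = ys @ u # zs"
    using assms(2) by (meson split_list)
  have "successively (\<lambda>x y. {x, y} \<in> edges T) ((ys @ [u]) @ zs)"
    using assms(1) by (simp add: xs path_between_def path_def)
  hence "successively (\<lambda>x y. {x, y} \<in> edges T) (ys @ [u])"
    unfolding successively_append_iff by blast
  hence "path_between T r u (ys @ [u])"
    using assms(1) by (auto simp: xs path_between_def path_def hd_append)
  with xs show ?thesis by (rule that)
qed

lemma child_subtree_verts_psubset:
  assumes T: "rooted_tree T r" and u: "u \<in> children T r v" and v: "v \<in> verts T"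
  shows "subtree_verts T r u \<subset> subtree_verts T r v"
proof -
  have anc: "ancestor T r v u" and e: "{v, u} \<in> edges T"
    using u by (auto simp: children_def)
  have "u \<noteq> v"
    using e T by (fastforce simp: rooted_tree_def tree_def forest_def simple_graph_def)
  have sub: "subtree_verts T r u \<subseteq> subtree_verts T r v"
  proof
    fix w assume w: "w \<in> subtree_verts T r u"
    have "v \<in> set xs" if xs: "path_between T r w xs" for xs
    proof -
      have "u \<in> set xs" using w xs by (auto simp: subtree_verts_def ancestor_def)
      with xs obtain ys zs where "xs = ys @ u # zs" "path_between T r u (ys @ [u])"
        by (rule path_between_prefix)
      thus ?thesis using anc \<open>u \<noteq> v\<close> by (auto simp: ancestor_def)
    qed
    thus "w \<in> subtree_verts T r v" using w by (auto simp: subtree_verts_def ancestor_def)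
  qed
  have "v \<in> subtree_verts T r v"
    using v by (auto simp: subtree_verts_def ancestor_def path_between_def path_def)
  moreover have "v \<notin> subtree_verts T r u"
  proof
    assume "v \<in> subtree_verts T r u"
    hence a: "ancestor T r u v" by (simp add: subtree_verts_def)
    obtain xs where xs: "path_between T r v xs"
      using T v by (auto simp: rooted_tree_def tree_def connected_def)
    with a have "u \<in> set xs" by (simp add: ancestor_def)
    with xs obtain ys zs where d: "xs = ys @ u # zs" "path_between T r u (ys @ [u])"
      by (rule path_between_prefix)
    have "v \<in> set ys" using anc d(2) \<open>u \<noteq> v\<close> by (fastforce simp: ancestor_def)
    moreover have "v \<in> set (u # zs)"
      using xs d(1) by (auto simp: path_between_def split: if_splits)
    ultimately show False using xs d(1) by (auto simp: path_between_def path_def)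
  qed
  ultimately show ?thesis using sub by blast
qed

text \<open>The first guard only makes the recursion total on arguments that are not vertices of a
  rooted tree. The recursive calls do not see the accumulated set, so the loop over the children
  amounts to a union. The empty parent is \<^term>\<open>None\<close>.\<close>

function claw_deletion_set_proc :: "'a graph \<Rightarrow> 'a \<Rightarrow> 'a \<Rightarrow> 'a option \<Rightarrow> 'a set" where
  "claw_deletion_set_proc T r v p =
     (if \<not> (rooted_tree T r \<and> v \<in> verts T) then {}
      else if children T r v = {} then {}
      else
        let S = (\<Union>u\<in>children T r v. claw_deletion_set_proc T r u (Some v));
            c = card (children T r v - S)
        in if 3 \<le> c then S \<union> {v}
           else if c = 2 \<and> p \<noteq> None \<and> v \<notin> S then S \<union> {the p}
           else S)"
  by pat_completeness auto
termination
proof (relation "measure (\<lambda>(T, r, v, p). card (subtree_verts T r v))", goal_cases)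
  case (2 T r v p u)
  have "finite (subtree_verts T r v)"
    using 2 by (auto simp: subtree_verts_def rooted_tree_def tree_def forest_def simple_graph_def)
  thus ?case using 2 child_subtree_verts_psubset[of T r u v]
    by (auto intro: psubset_card_mono)
qed simp

declare claw_deletion_set_proc.simps [simp del]


section \<open>Linear time\<close>

text \<open>Time is measured on a unit-cost random access machine over the natural numbers with
  constants, addition, (truncated) subtraction and indirect addressing, programmed with structured
  control flow. A state consists of the registers and the memory. Each elementary instruction and
  each evaluation of a test takes one time unit.\<close>

datatype ram_prog =
    Skip
  | Const nat nat
  | Add nat nat nat
  | Sub nat nat nat
  | Load nat nat
  | Store nat nat
  | Seq ram_prog ram_prog
  | IfNz nat ram_prog ram_prog
  | WhileNz nat ram_prog

type_synonym ram_state = "(nat \<Rightarrow> nat) \<times> (nat \<Rightarrow> nat)"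

inductive ram_exec :: "ram_prog \<Rightarrow> ram_state \<Rightarrow> nat \<Rightarrow> ram_state \<Rightarrow> bool" where
  "ram_exec Skip s 1 s"
| "ram_exec (Const i c) (R, M) 1 (R(i := c), M)"
| "ram_exec (Add i j k) (R, M) 1 (R(i := R j + R k), M)"
| "ram_exec (Sub i j k) (R, M) 1 (R(i := R j - R k), M)"
| "ram_exec (Load i j) (R, M) 1 (R(i := M (R j)), M)"
| "ram_exec (Store i j) (R, M) 1 (R, M(R i := R j))"
| "ram_exec P s t s' \<Longrightarrow> ram_exec Q s' t' s'' \<Longrightarrow> ram_exec (Seq P Q) s (t + t') s''"
| "fst s i \<noteq> 0 \<Longrightarrow> ram_exec P s t s' \<Longrightarrow> ram_exec (IfNz i P Q) s (1 + t) s'"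
| "fst s i = 0 \<Longrightarrow> ram_exec Q s t s' \<Longrightarrow> ram_exec (IfNz i P Q) s (1 + t) s'"
| "fst s i = 0 \<Longrightarrow> ram_exec (WhileNz i P) s 1 s"
| "fst s i \<noteq> 0 \<Longrightarrow> ram_exec P s t s' \<Longrightarrow> ram_exec (WhileNz i P) s' t' s'' \<Longrightarrow>
     ram_exec (WhileNz i P) s (1 + t + t') s''"

definition ram_init :: "nat list \<Rightarrow> ram_state" where
  "ram_init xs = (\<lambda>_. 0, \<lambda>i. if i < length xs then xs ! i else 0)"

text \<open>\<^term>\<open>enc xs x\<close> says that the word \<^term>\<open>xs\<close> is an encoding of the instance \<^term>\<open>x\<close>.
  The answer is delivered in register 0.\<close>

definition linear_time_decidable ::
    "(nat list \<Rightarrow> 'i \<Rightarrow> bool) \<Rightarrow> ('i \<Rightarrow> bool) \<Rightarrow> ('i \<Rightarrow> bool) \<Rightarrow> bool" where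
  "linear_time_decidable enc inst yes \<longleftrightarrow>
     (\<exists>P c. \<forall>x xs. inst x \<longrightarrow> enc xs x \<longrightarrow>
        (\<exists>t R M. ram_exec P (ram_init xs) t (R, M) \<and> t \<le> c * (length xs + 1) \<and>
           R 0 = (if yes x then 1 else 0)))"

text \<open>Adjacency-list encoding of a graph with vertices \<open>0, \<dots>, n - 1\<close> together with a number
  \<^term>\<open>k\<close>: the number of vertices, \<^term>\<open>k\<close>, and then, vertex by vertex, the degree followed by
  the neighbours in arbitrary order. The length of the encoding is \<open>2 + |V| + 2 |E|\<close>.\<close>

definition adj_list_encoding :: "nat list \<Rightarrow> nat graph \<times> nat \<Rightarrow> bool" where
  "adj_list_encoding xs = (\<lambda>(G, k). \<exists>adj.
     verts G = {..<length adj} \<and>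
     (\<forall>i<length adj. distinct (adj ! i) \<and> set (adj ! i) = {j. {i, j} \<in> edges G}) \<and>
     xs = length adj # k # concat (map (\<lambda>ns. length ns # ns) adj))"

definition linear_forest_deletion_instance :: "nat graph \<times> nat \<Rightarrow> bool" where
  "linear_forest_deletion_instance = (\<lambda>(F, k). forest F \<and> 0 < k)"

definition linear_forest_deletion_yes :: "nat graph \<times> nat \<Rightarrow> bool" where
  "linear_forest_deletion_yes = (\<lambda>(F, k).
     \<exists>S\<subseteq>verts F. card S \<le> k \<and> linear_forest (delete_verts F S))"

end

theory Submission
  imports Defs
begin

text \<open>A forest is claw-free iff all its degrees are at most 2, and iff it is a linear forest, so a
  claw-deletion set is a set of vertices whose removal leaves maximum degree at most 2.

  For the procedure, let \<open>A\<close> be the sum of the claw-deletion numbers of the child subtrees of \<open>v\<close>,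
  which is the claw-deletion number of \<open>T\<^sub>v - v\<close>. If some child forces the deletion of \<open>v\<close>, then
  \<open>A + 1\<close> vertices are needed and suffice. Otherwise a deletion set of size \<open>A\<close> is minimum in each
  child subtree, hence avoids every child that is not in the computed set; so it exists iff \<open>v\<close> has
  at most two such neighbours, counting the parent in the case of \<open>T\<^sub>v\<^sup>+\<close>.

  For linear time, leaves are peeled off instead of recursing from a root. Each vertex carries a
  weight, the number of its kept neighbours among those already peeled off, and weight at least 3
  means that it must be deleted. Peeling a leaf of weight \<open>c\<close> adds to its neighbour 0 if
  \<open>c \<ge> 3\<close> (the leaf is deleted), 3 if \<open>c = 2\<close> (the neighbour is deleted), and 1 otherwise. This
  preserves the weighted minimum, and when no edge is left, the vertices of weight at least 3 are
  counted.\<close>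

section \<open>Degrees in forests\<close>

definition nbrs :: "'a set set \<Rightarrow> 'a \<Rightarrow> 'a set" where
  "nbrs E v = {u. {v, u} \<in> E}"

lemma nbrs_sym: "u \<in> nbrs E v \<longleftrightarrow> v \<in> nbrs E u"
  by (simp add: nbrs_def insert_commute)

lemma nbrs_subset_verts: "simple_graph G \<Longrightarrow> nbrs (edges G) v \<subseteq> verts G"
  by (auto simp: nbrs_def simple_graph_def)

lemma finite_nbrs: "simple_graph G \<Longrightarrow> finite (nbrs (edges G) v)"
  by (meson finite_subset nbrs_subset_verts simple_graph_def)

lemma self_notin_nbrs: "simple_graph G \<Longrightarrow> v \<notin> nbrs (edges G) v"
  by (fastforce simp: nbrs_def simple_graph_def)

lemma nbrs_induced: "v \<in> X \<Longrightarrow> nbrs (edges (induced G X)) v = nbrs (edges G) v \<inter> X"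
  by (auto simp: nbrs_def induced_def)

lemma induced_verts: "simple_graph G \<Longrightarrow> induced G (verts G) = G"
  by (cases G) (auto simp: induced_def simple_graph_def)

lemma delete_verts_induced:
  "X \<subseteq> verts G \<Longrightarrow> delete_verts (induced G X) S = induced G (X - S)"
  by (auto simp: induced_def delete_verts_def)

lemma successively_edges_mono:
  "successively (\<lambda>x y. {x, y} \<in> E) xs \<Longrightarrow> E \<subseteq> F \<Longrightarrow> successively (\<lambda>x y. {x, y} \<in> F) xs"
  by (erule successively_mono) auto

lemma forest_subgraph:
  assumes "forest G" "verts H \<subseteq> verts G" "edges H \<subseteq> edges G" "simple_graph H"
  shows "forest H"
  using assms successively_edges_mono[of "edges H" _ "edges G"]
  by (fastforce simp: forest_def cycle_def path_def)

lemma forest_induced: "forest G \<Longrightarrow> forest (induced G X)"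
  by (rule forest_subgraph) (auto simp: induced_def simple_graph_def forest_def)

section \<open>Claw-free forests and vertex degrees\<close>

lemma forest_no_triangle:
  assumes "forest G" "a \<in> nbrs (edges G) v" "b \<in> nbrs (edges G) v"
  shows "{a, b} \<notin> edges G"
proof
  assume "{a, b} \<in> edges G"
  moreover have "simple_graph G" using assms by (simp add: forest_def)
  ultimately have "cycle G [v, a, b]"
    using assms(2,3) unfolding cycle_def path_def nbrs_def simple_graph_def
    by (fastforce simp: insert_commute)
  then show False using assms(1) by (auto simp: forest_def)
qed

lemma card_ge_3_obtain:
  assumes "3 \<le> card A"
  obtains a b c where "a \<in> A" "b \<in> A" "c \<in> A" "a \<noteq> b" "a \<noteq> c" "b \<noteq> c"
proof -
  obtain B where "B \<subseteq> A" "card B = 3" using assms by (meson obtain_subset_with_card_n)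
  then show ?thesis using that by (auto simp: card_3_iff)
qed

text \<open>Without triangles, any three neighbours of a vertex are pairwise non-adjacent and span
  an induced claw with it. Conversely, the centre of an induced claw has three neighbours.\<close>

lemma claw_free_iff_degree_le_2:
  assumes "forest G"
  shows "claw_free G \<longleftrightarrow> (\<forall>v\<in>verts G. card (nbrs (edges G) v) \<le> 2)"
proof
  have sg: "simple_graph G" using assms by (simp add: forest_def)
  show "\<forall>v\<in>verts G. card (nbrs (edges G) v) \<le> 2" if "claw_free G"
  proof (rule ccontr)
    assume "\<not> ?thesis"
    then obtain v where v: "v \<in> verts G" "3 \<le> card (nbrs (edges G) v)" by fastforce
    then obtain a b c where abc: "a \<in> nbrs (edges G) v" "b \<in> nbrs (edges G) v"
      "c \<in> nbrs (edges G) v" "a \<noteq> b" "a \<noteq> c" "b \<noteq> c" by (meson card_ge_3_obtain)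
    then have ne: "a \<noteq> v" "b \<noteq> v" "c \<noteq> v" using self_notin_nbrs[OF sg] by auto
    let ?X = "{v, a, b, c}"
    have X: "?X \<subseteq> verts G" using v abc nbrs_subset_verts[OF sg] by auto
    have E: "edges (induced G ?X) = {{v, a}, {v, b}, {v, c}}"
    proof
      show "{{v, a}, {v, b}, {v, c}} \<subseteq> edges (induced G ?X)"
        using abc by (auto simp: induced_def nbrs_def)
      show "edges (induced G ?X) \<subseteq> {{v, a}, {v, b}, {v, c}}"
      proof
        fix e assume "e \<in> edges (induced G ?X)"
        then have e: "e \<in> edges G" "e \<subseteq> ?X" "card e = 2"
          using sg by (auto simp: induced_def simple_graph_def)
        from e(3) obtain x y where xy: "e = {x, y}" "x \<noteq> y" by (meson card_2_iff)
        have "{a, b} \<notin> edges G" "{a, c} \<notin> edges G" "{b, c} \<notin> edges G"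
          using abc forest_no_triangle[OF assms] by auto
        then show "e \<in> {{v, a}, {v, b}, {v, c}}"
          using e xy by (auto simp: insert_commute)
      qed
    qed
    define f :: "'a \<Rightarrow> nat" where "f x = (if x = v then 0 else if x = a then 1 else if x = b then 2 else 3)" for x
    have f: "f v = 0" "f a = 1" "f b = 2" "f c = 3" using abc ne by (auto simp: f_def)
    have "bij_betw f (verts (induced G ?X)) (verts claw)"
      using f X abc ne by (auto simp: bij_betw_def inj_on_def claw_def induced_def)
    moreover have "edges claw = (\<lambda>e. f ` e) ` edges (induced G ?X)"
      unfolding E using f by (simp add: claw_def)
    ultimately show False using that X unfolding claw_free_def graph_iso_def by blast
  qed
  show "claw_free G" if deg: "\<forall>v\<in>verts G. card (nbrs (edges G) v) \<le> 2"
    unfolding claw_free_def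
  proof
    assume "\<exists>X\<subseteq>verts G. graph_iso (induced G X) claw"
    then obtain X f where X: "X \<subseteq> verts G" and f: "bij_betw f X {0, 1, 2, 3::nat}"
      and E: "{{0, 1}, {0, 2}, {0, 3}} = (\<lambda>e. f ` e) ` {e \<in> edges G. e \<subseteq> X}"
      by (auto simp: graph_iso_def induced_def claw_def Int_absorb1)
    \<comment> \<open>Pulling the claw back along the isomorphism: \<open>g 0\<close> is the centre,
      and \<open>g 1\<close>, \<open>g 2\<close>, \<open>g 3\<close> are three distinct neighbours
      of it.\<close>
    define g where "g = inv_into X f"
    have g: "g i \<in> X" "f (g i) = i" if "i \<in> {0, 1, 2, 3}" for i
      using f that by (auto simp: g_def bij_betw_def inv_into_into f_inv_into_f)
    have inj: "inj_on f X" using f by (simp add: bij_betw_def)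
    have "g i \<in> nbrs (edges G) (g 0)" if "i \<in> {1, 2, 3}" for i
    proof -
      have "{0, i} \<in> (\<lambda>e. f ` e) ` {e \<in> edges G. e \<subseteq> X}" unfolding E[symmetric] using that by auto
      then obtain e where e: "e \<in> edges G" "e \<subseteq> X" "f ` e = {0, i}" by auto
      have "f ` {g 0, g i} = {0, i}" using g that by auto
      then have "e = {g 0, g i}"
        using e inj g that by (intro inj_on_image_eq_iff[OF inj, THEN iffD1]) auto
      then show ?thesis using e by (simp add: nbrs_def)
    qed
    then have "g ` {1, 2, 3} \<subseteq> nbrs (edges G) (g 0)" by auto
    moreover have "inj_on g {1, 2, 3}" by (rule inj_on_inverseI[of _ f]) (use g in auto)
    then have "card (g ` {1, 2, 3}) = 3" by (simp add: card_image)
    ultimately have "3 \<le> card (nbrs (edges G) (g 0))"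
      by (metis card_mono finite_nbrs sg)
    then show False using deg X g(1)[of 0] by fastforce
  qed
qed

text \<open>Weights model neighbours that have already been processed and are kept.\<close>

definition deletion_set :: "'a set \<Rightarrow> 'a set set \<Rightarrow> ('a \<Rightarrow> nat) \<Rightarrow> 'a set \<Rightarrow> bool" where
  "deletion_set V E w S \<longleftrightarrow> S \<subseteq> V \<and> (\<forall>v\<in>V - S. w v + card (nbrs E v \<inter> V - S) \<le> 2)"

text \<open>Deleting \<open>S\<close> from the subgraph induced by \<open>X\<close> leaves the one
  induced by \<open>X - S\<close>, so with zero weights the degree criterion for claw-freeness is
  the condition in \<open>deletion_set\<close>.\<close>

lemma claw_deletion_set_induced_iff:
  assumes "forest G" "X \<subseteq> verts G"
  shows "claw_deletion_set (induced G X) S \<longleftrightarrow> deletion_set X (edges G) (\<lambda>_. 0) S"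
proof -
  have "verts (induced G X) = X" "verts (induced G (X - S)) = X - S"
    using assms(2) by (auto simp: induced_def)
  moreover have "nbrs (edges G) v \<inter> (X - S) = nbrs (edges G) v \<inter> X - S" for v by auto
  ultimately show ?thesis
    using assms by (auto simp: claw_deletion_set_def deletion_set_def delete_verts_induced
        claw_free_iff_degree_le_2 forest_induced nbrs_induced)
qed

section \<open>Longest paths and leaves\<close>

lemma exists_longest_path:
  assumes "simple_graph G" "path G ys"
  obtains xs where "path G xs" "length ys \<le> length xs" "\<And>zs. path G zs \<Longrightarrow> length zs \<le> length xs"
proof -
  have "length zs < Suc (card (verts G))" if "path G zs" for zs
    using that assms(1) by (metis card_mono distinct_card le_imp_less_Suc path_def simple_graph_def)
  then show ?thesis
    using ex_has_greatest_nat[of "path G" ys length] assms(2) that by blast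
qed

lemma path_rev: "path G (rev xs) \<longleftrightarrow> path G xs"
  by (simp add: path_def insert_commute)

lemma path_take:
  assumes "path G xs"
  shows "path G (take (Suc n) xs)"
proof -
  have "successively (\<lambda>x y. {x, y} \<in> edges G) (take (Suc n) xs @ drop (Suc n) xs)"
    using assms by (simp add: path_def)
  then have "successively (\<lambda>x y. {x, y} \<in> edges G) (take (Suc n) xs)"
    unfolding successively_append_iff by blast
  then show ?thesis using assms set_take_subset[of "Suc n" xs] by (auto simp: path_def)
qed

text \<open>A neighbour of the first vertex outside the path would extend it, and one at position 2
  or later would close a cycle with the part of the path before it.\<close>

lemma longest_path_nbr_hd:
  assumes "forest G" "path G xs" "\<And>zs. path G zs \<Longrightarrow> length zs \<le> length xs"
    and u: "{hd xs, u} \<in> edges G"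
  shows "1 < length xs \<and> u = xs ! 1"
proof -
  have sg: "simple_graph G" using assms by (simp add: forest_def)
  have ne: "xs \<noteq> []" using assms by (simp add: path_def)
  have "u \<in> set xs"
  proof (rule ccontr)
    assume "u \<notin> set xs"
    then have "path G (u # xs)"
      using assms(2) u sg by (auto simp: path_def successively_Cons insert_commute simple_graph_def)
    then show False using assms(3) by fastforce
  qed
  then obtain j where j: "j < length xs" "u = xs ! j" by (auto simp: in_set_conv_nth)
  have "j \<noteq> 0"
    using u j ne self_notin_nbrs[OF sg, of u] by (auto simp: nbrs_def hd_conv_nth intro: ccontr)
  moreover have "\<not> 2 \<le> j"
  proof
    assume "2 \<le> j"
    moreover have "last (take (Suc j) xs) = u" using j by (simp add: take_Suc_conv_app_nth)
    ultimately have "cycle G (take (Suc j) xs)"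
      using j u assms(2) by (simp add: cycle_def path_take insert_commute)
    then show False using assms(1) by (auto simp: forest_def)
  qed
  ultimately have "j = 1" by simp
  then show ?thesis using j by simp
qed

text \<open>The first vertex of a longest path is a leaf. An edge is itself a path with two
  vertices, so a longest path has a second vertex, the neighbour of the first.\<close>

lemma forest_edge_imp_leaf:
  assumes "forest G" "edges G \<noteq> {}"
  obtains v where "v \<in> verts G" "card (nbrs (edges G) v) = 1"
proof -
  have sg: "simple_graph G" using assms by (simp add: forest_def)
  obtain a b where ab: "{a, b} \<in> edges G" "a \<noteq> b"
    using assms(2) sg unfolding simple_graph_def by (metis card_2_iff ex_in_conv)
  then have "path G [a, b]" using sg by (auto simp: path_def simple_graph_def)
  then obtain xs where xs: "path G xs" "2 \<le> length xs" "\<And>zs. path G zs \<Longrightarrow> length zs \<le> length xs"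
    using exists_longest_path[OF sg] by (metis One_nat_def Suc_1 length_Cons list.size(3))
  have "nbrs (edges G) (hd xs) \<subseteq> {xs ! 1}"
    using longest_path_nbr_hd[OF assms(1) xs(1,3)] by (auto simp: nbrs_def)
  moreover have "xs ! 1 \<in> nbrs (edges G) (hd xs)"
    using xs by (cases xs; cases "tl xs") (auto simp: path_def nbrs_def)
  ultimately have "nbrs (edges G) (hd xs) = {xs ! 1}" by auto
  moreover have "hd xs \<in> verts G" using xs by (auto simp: path_def)
  ultimately show ?thesis using that by simp
qed

text \<open>A longest path is a whole component without chords: an end has only its path neighbour,
  and the two path neighbours of an inner vertex already exhaust its degree.\<close>

lemma longest_path_edge:
  assumes "forest G" "\<And>v. v \<in> verts G \<Longrightarrow> card (nbrs (edges G) v) \<le> 2"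
    and xs: "path G xs" "\<And>zs. path G zs \<Longrightarrow> length zs \<le> length xs"
    and e: "x \<in> set xs" "{x, u} \<in> edges G"
  shows "\<exists>i. {x, u} = {xs ! i, xs ! Suc i} \<and> Suc i < length xs"
proof -
  have sg: "simple_graph G" using assms by (simp add: forest_def)
  have ne: "xs \<noteq> []" using xs by (simp add: path_def)
  obtain i where i: "i < length xs" "x = xs ! i" using e by (auto simp: in_set_conv_nth)
  consider "i = 0" | "Suc i = length xs" | "0 < i" "Suc i < length xs" using i by linarith
  then show ?thesis
  proof cases
    case 1
    then have "hd xs = x" using i ne by (simp add: hd_conv_nth)
    then show ?thesis using longest_path_nbr_hd[OF assms(1) xs] e i 1
      by (intro exI[of _ 0]) auto
  next
    case 2
    then have i': "i = length xs - 1" by simp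
    \<comment> \<open>The reversed path is again longest, which reduces the last vertex to the first
      one.\<close>
    have "hd (rev xs) = x" using i(2) ne unfolding i' by (simp add: hd_rev last_conv_nth)
    then have "1 < length xs \<and> u = rev xs ! 1"
      using longest_path_nbr_hd[OF assms(1), of "rev xs" u] xs e by (auto simp: path_rev)
    then show ?thesis using i(2) unfolding i'
      by (intro exI[of _ "length xs - 2"]) (auto simp: rev_nth insert_commute numeral_2_eq_2 Suc_diff_Suc)
  next
    case 3
    have suc: "{xs ! j, xs ! Suc j} \<in> edges G" if "Suc j < length xs" for j
      using xs(1) that successively_nth[of "\<lambda>x y. {x, y} \<in> edges G" xs j] by (simp add: path_def)
    have "{xs ! (i - 1), xs ! Suc i} \<subseteq> nbrs (edges G) x"
      using suc[of "i - 1"] suc[of i] 3 i by (auto simp: nbrs_def insert_commute)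
    moreover have "xs ! (i - 1) \<noteq> xs ! Suc i"
      using xs(1) 3 by (simp add: path_def nth_eq_iff_index_eq)
    moreover have "card (nbrs (edges G) x) \<le> 2" using assms(2) e xs(1) by (auto simp: path_def)
    ultimately have "{xs ! (i - 1), xs ! Suc i} = nbrs (edges G) x"
      by (intro card_seteq finite_nbrs[OF sg]) auto
    then have "u = xs ! (i - 1) \<or> u = xs ! Suc i" using e(2) by (auto simp: nbrs_def)
    then show ?thesis
    proof
      assume "u = xs ! (i - 1)"
      then show ?thesis using 3 i by (intro exI[of _ "i - 1"]) auto
    next
      assume "u = xs ! Suc i"
      then show ?thesis using 3 i by auto
    qed
  qed
qed

section \<open>Linear forests as forests of maximum degree two\<close>

text \<open>Induction on the number of vertices. The vertices of a longest path form one block,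
  since by \<open>longest_path_edge\<close> no edge leaves them; the rest is a smaller forest with
  the same degree bound.\<close>

lemma linear_forest_if_degree_le_2:
  assumes "forest G" "\<And>v. v \<in> verts G \<Longrightarrow> card (nbrs (edges G) v) \<le> 2"
  shows "linear_forest G"
  using assms
proof (induction "card (verts G)" arbitrary: G rule: less_induct)
  case less
  have sg: "simple_graph G" using less.prems by (simp add: forest_def)
  show ?case
  proof (cases "verts G = {}")
    case True
    then have "edges G = {}" using sg by (fastforce simp: simple_graph_def)
    with True show ?thesis by (auto simp: linear_forest_def partition_on_def intro!: exI[of _ "{}"])
  next
    case False
    then obtain a where "a \<in> verts G" by auto
    then have "path G [a]" by (simp add: path_def)
    then obtain xs where xs: "path G xs" "\<And>zs. path G zs \<Longrightarrow> length zs \<le> length xs"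
      using exists_longest_path[OF sg] by metis
    note ed = longest_path_edge[OF less.prems xs]
    let ?X = "set xs" and ?H = "delete_verts G (set xs)"
    have X: "?X \<subseteq> verts G" "?X \<noteq> {}" "distinct xs" using xs by (auto simp: path_def)
    have VH: "verts ?H = verts G - ?X" by (auto simp: delete_verts_def induced_def)
    have "verts G - ?X \<subset> verts G" using X(1,2)
      by (metis Diff_iff Diff_subset all_not_in_conv psubsetI subset_iff)
    then have "card (verts ?H) < card (verts G)"
      unfolding VH using sg by (simp add: psubset_card_mono simple_graph_def)
    moreover have "forest ?H" unfolding delete_verts_def by (rule forest_induced) fact
    moreover have "card (nbrs (edges ?H) v) \<le> 2" if "v \<in> verts ?H" for v
    proof -
      have "nbrs (edges ?H) v \<subseteq> nbrs (edges G) v" by (auto simp: nbrs_def delete_verts_def induced_def)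
      then have "card (nbrs (edges ?H) v) \<le> card (nbrs (edges G) v)"
        by (rule card_mono[OF finite_nbrs[OF sg]])
      also have "\<dots> \<le> 2" using less.prems(2) that VH by simp
      finally show ?thesis .
    qed
    ultimately have "linear_forest ?H" by (rule less.hyps)
    then obtain P where P: "partition_on (verts G - ?X) P" "\<And>Q. Q \<in> P \<Longrightarrow> path_graph (induced ?H Q)"
      "\<And>e. e \<in> edges ?H \<Longrightarrow> \<exists>Q\<in>P. e \<subseteq> Q" unfolding linear_forest_def VH by blast
    have "partition_on (verts G) (insert ?X P)"
      using partition_on_insert[of ?X P "verts G"] P(1) X
      by (auto simp: partition_on_def disjnt_def)
    moreover have "path_graph (induced G Q)" if "Q \<in> insert ?X P" for Q
    proof (cases "Q = ?X")
      case True
      have "edges (induced G ?X) = {{xs ! i, xs ! Suc i} | i. Suc i < length xs}" (is "?L = ?R")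
      proof
        show "?L \<subseteq> ?R"
        proof
          fix e assume "e \<in> ?L"
          then have e: "e \<in> edges G" "e \<subseteq> ?X" by (auto simp: induced_def)
          then obtain x y where "e = {x, y}" using sg by (metis card_2_iff simple_graph_def)
          then show "e \<in> ?R" using ed[of x y] e by auto
        qed
        show "?R \<subseteq> ?L" using xs(1) successively_nth[of "\<lambda>x y. {x, y} \<in> edges G" xs]
          by (auto simp: path_def induced_def)
      qed
      then show ?thesis using X True unfolding path_graph_def
        by (intro exI[of _ xs]) (auto simp: induced_def)
    next
      case False
      then have "Q \<in> P" using that by simp
      then have "Q \<subseteq> verts G - ?X" using P(1) by (auto simp: partition_on_def)
      then have "induced ?H Q = induced G Q" by (auto simp: delete_verts_def induced_def)
      then show ?thesis using P(2)[OF \<open>Q \<in> P\<close>] by simp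
    qed
    moreover have "\<exists>Q\<in>insert ?X P. e \<subseteq> Q" if e: "e \<in> edges G" for e
    proof (cases "e \<inter> ?X = {}")
      case True
      then have "e \<in> edges ?H" using e sg by (auto simp: delete_verts_def induced_def simple_graph_def)
      then show ?thesis using P(3) by auto
    next
      case False
      then obtain x where x: "x \<in> e" "x \<in> ?X" by auto
      then obtain y where "e = {x, y}"
        using sg e by (metis card_2_iff simple_graph_def insert_iff insert_commute singletonD)
      then have "e \<subseteq> ?X" using ed[of x y] e x by auto
      then show ?thesis by auto
    qed
    ultimately show ?thesis unfolding linear_forest_def by blast
  qed
qed

text \<open>Every edge lies inside a block, so all neighbours of \<open>v\<close> lie in its own
  block, where they are its predecessor and successor on the path.\<close>

lemma degree_le_2_if_linear_forest:
  assumes "simple_graph G" "linear_forest G" "v \<in> verts G"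
  shows "card (nbrs (edges G) v) \<le> 2"
proof -
  obtain P where P: "partition_on (verts G) P" "\<And>Q. Q \<in> P \<Longrightarrow> path_graph (induced G Q)"
      "\<And>e. e \<in> edges G \<Longrightarrow> \<exists>Q\<in>P. e \<subseteq> Q" using assms unfolding linear_forest_def by blast
  obtain Q where Q: "Q \<in> P" "v \<in> Q" using P(1) assms(3) by (auto simp: partition_on_def)
  have Qv: "Q \<subseteq> verts G" using P(1) Q by (auto simp: partition_on_def)
  obtain xs where xs: "distinct xs" "Q = set xs"
    "edges (induced G Q) = {{xs ! i, xs ! Suc i} | i. Suc i < length xs}"
    using P(2)[OF Q(1)] Qv by (auto simp: path_graph_def induced_def Int_absorb1)
  obtain i where i: "i < length xs" "v = xs ! i" using Q xs by (auto simp: in_set_conv_nth)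
  \<comment> \<open>At an end of the path one of the two entries is not a neighbour:
    \<open>i - 1\<close> is \<open>i\<close> for \<open>i = 0\<close>, and \<open>Suc i\<close> may
    be out of range. The inclusion still holds and bounds the degree by 2.\<close>
  have "nbrs (edges G) v \<subseteq> {xs ! (i - 1), xs ! Suc i}"
  proof
    fix u assume u: "u \<in> nbrs (edges G) v"
    then obtain Q' where Q': "Q' \<in> P" "{v, u} \<subseteq> Q'" using P(3) unfolding nbrs_def by blast
    then have "Q' = Q" using P(1) Q by (auto simp: partition_on_def disjoint_def)
    then have "{v, u} \<in> edges (induced G Q)" using Q' u by (auto simp: induced_def nbrs_def)
    then obtain j where j: "{v, u} = {xs ! j, xs ! Suc j}" "Suc j < length xs" using xs by auto
    then have "v = xs ! j \<and> u = xs ! Suc j \<or> v = xs ! Suc j \<and> u = xs ! j" by (auto simp: doubleton_eq_iff)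
    then show "u \<in> {xs ! (i - 1), xs ! Suc i}"
      using i j(2) xs(1) by (auto simp: nth_eq_iff_index_eq)
  qed
  then have "card (nbrs (edges G) v) \<le> card {xs ! (i - 1), xs ! Suc i}" by (intro card_mono) auto
  also have "\<dots> \<le> 2" by (simp add: card_insert_if)
  finally show ?thesis .
qed

lemma linear_forest_iff_claw_free: "forest G \<Longrightarrow> linear_forest G \<longleftrightarrow> claw_free G"
  using linear_forest_if_degree_le_2 degree_le_2_if_linear_forest
  by (metis claw_free_iff_degree_le_2 forest_def)

section \<open>Uniqueness of paths in a forest\<close>

text \<open>If two paths separate after \<open>u\<close>, going along the first until it meets the
  second again and returning along the second closes a cycle.\<close>

lemma forest_unique_path:
  assumes "forest G" "path_between G u v xs" "path_between G u v ys"
  shows "xs = ys"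
  using assms(2,3)
proof (induction xs arbitrary: u ys)
  case Nil
  then show ?case by (simp add: path_between_def path_def)
next
  case (Cons a xs)
  obtain ys' where ys: "ys = u # ys'" and a: "a = u"
    using Cons.prems unfolding path_between_def path_def by (metis list.collapse list.sel(1))
  have d: "u \<notin> set xs" "u \<notin> set ys'" "distinct xs" "distinct ys'"
    using Cons.prems a ys by (auto simp: path_between_def path_def)
  show ?case
  proof (cases "xs = [] \<or> ys' = []")
    case True
    then show ?thesis using Cons.prems a ys d
      by (auto simp: path_between_def split: if_splits)
  next
    case False
    then obtain x xs1 y ys1 where xy: "xs = x # xs1" "ys' = y # ys1"
      by (meson neq_Nil_conv)
    have px: "path_between G x v xs" and py: "path_between G y v ys'"
      using Cons.prems a ys xy by (auto simp: path_between_def path_def)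
    show ?thesis
    proof (cases "x = y")
      case True
      then show ?thesis using Cons.IH[OF px] py a ys by auto
    next
      case neq: False
      have "\<exists>b\<in>set xs. b \<in> set ys'" using px py
        by (metis last_in_set path_between_def path_def)
      \<comment> \<open>\<open>b\<close> is the first vertex of \<open>xs\<close> on
        \<open>ys'\<close>, so \<open>as\<close> avoids \<open>ys'\<close> and the closed walk built
        from \<open>as\<close> and \<open>cs\<close> repeats no vertex.\<close>
      then obtain as b bs where ab: "xs = as @ b # bs" "b \<in> set ys'" "\<forall>z\<in>set as. z \<notin> set ys'"
        using split_list_first_prop[of xs "\<lambda>b. b \<in> set ys'"] by blast
      obtain cs ds where cd: "ys' = cs @ b # ds" using ab(2) by (meson split_list)
      let ?c = "u # as @ b # rev cs"
      have 1: "successively (\<lambda>x y. {x, y} \<in> edges G) ((u # as @ [b]) @ bs)"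
        using Cons.prems(1) a ab(1) by (simp add: path_between_def path_def)
      have 2: "successively (\<lambda>x y. {x, y} \<in> edges G) ((cs @ [b]) @ ds)"
        using py cd by (simp add: path_between_def path_def)
      have "successively (\<lambda>x y. {x, y} \<in> edges G) (u # as @ [b])"
        using 1 unfolding successively_append_iff by blast
      moreover have "successively (\<lambda>x y. {x, y} \<in> edges G) (rev (cs @ [b]))"
        unfolding successively_rev using 2 unfolding successively_append_iff by (simp add: insert_commute)
      ultimately have "successively (\<lambda>x y. {x, y} \<in> edges G) ((u # as) @ b # rev cs)"
        by (simp add: successively_append_iff successively_Cons hd_append split: if_splits)
      moreover have "distinct ?c" using d ab cd by auto
      moreover have "set ?c \<subseteq> verts G"
        using Cons.prems a ys ab cd by (auto simp: path_between_def path_def)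
      ultimately have "path G ?c" by (simp add: path_def)
      moreover have "3 \<le> length ?c"
        using neq ab(1) cd xy by (cases as; cases cs) auto
      moreover have "last ?c = y" using cd xy by (cases cs) auto
      then have "{last ?c, hd ?c} \<in> edges G"
        using Cons.prems(2) ys xy by (simp add: path_between_def path_def insert_commute)
      ultimately have "cycle G ?c" by (simp add: cycle_def)
      then show ?thesis using assms(1) by (auto simp: forest_def)
    qed
  qed
qed

section \<open>The procedure on rooted trees\<close>

text \<open>Passing to fewer vertices only lowers degrees.\<close>

lemma deletion_set_restrict:
  assumes "simple_graph G" "deletion_set X (edges G) w S" "Y \<subseteq> X"
  shows "deletion_set Y (edges G) w (S \<inter> Y)"
  unfolding deletion_set_def
proof (intro conjI ballI)
  fix v assume v: "v \<in> Y - S \<inter> Y"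
  have "card (nbrs (edges G) v \<inter> Y - S \<inter> Y) \<le> card (nbrs (edges G) v \<inter> X - S)"
    using assms by (intro card_mono) (auto simp: finite_nbrs)
  moreover have "w v + card (nbrs (edges G) v \<inter> X - S) \<le> 2"
    using assms v by (auto simp: deletion_set_def)
  ultimately show "w v + card (nbrs (edges G) v \<inter> Y - S \<inter> Y) \<le> 2" by linarith
qed simp

lemma deletion_set_subset_finite:
  "deletion_set X E w S \<Longrightarrow> finite X \<Longrightarrow> finite S"
  by (auto simp: deletion_set_def intro: finite_subset)

locale rooted =
  fixes T :: "'a graph" and r :: 'a
  assumes rooted_tree: "rooted_tree T r"
begin

lemma forest: "forest T" and simple: "simple_graph T" and finite_verts: "finite (verts T)"
  using rooted_tree by (auto simp: rooted_tree_def tree_def forest_def simple_graph_def)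

abbreviation E :: "'a set set" where "E \<equiv> edges T"

abbreviation V\<^sub>s :: "'a \<Rightarrow> 'a set" where "V\<^sub>s \<equiv> subtree_verts T r"

abbreviation children_of :: "'a \<Rightarrow> 'a set" where "children_of \<equiv> children T r"

section \<open>Root paths, children and parents\<close>

lemma edge_verts: "{u, v} \<in> E \<Longrightarrow> u \<in> verts T \<and> v \<in> verts T \<and> u \<noteq> v"
  using simple self_notin_nbrs[OF simple] by (auto simp: simple_graph_def nbrs_def)

text \<open>Paths in a forest are unique, so the ancestors of \<open>w\<close> can be read off one
  list. Child, parent and subtree then become statements about prefixes of such lists.\<close>

definition root_path :: "'a \<Rightarrow> 'a list" where
  "root_path w = (THE xs. path_between T r w xs)"

lemma root_path_eq: "path_between T r w xs \<Longrightarrow> root_path w = xs"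
  using forest_unique_path[OF forest] unfolding root_path_def by blast

lemma path_between_root_path: "w \<in> verts T \<Longrightarrow> path_between T r w (root_path w)"
proof -
  assume "w \<in> verts T"
  then obtain xs where "path_between T r w xs"
    using rooted_tree by (auto simp: rooted_tree_def tree_def connected_def)
  then show ?thesis using root_path_eq by metis
qed

lemma root_path_props:
  assumes "w \<in> verts T"
  shows "root_path w \<noteq> []" "distinct (root_path w)" "hd (root_path w) = r" "last (root_path w) = w"
    "set (root_path w) \<subseteq> verts T" "successively (\<lambda>x y. {x, y} \<in> E) (root_path w)"
    "w \<in> set (root_path w)"
proof -
  show *: "root_path w \<noteq> []" "distinct (root_path w)" "hd (root_path w) = r" "last (root_path w) = w"
    "set (root_path w) \<subseteq> verts T" "successively (\<lambda>x y. {x, y} \<in> E) (root_path w)"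
    using path_between_root_path[OF assms] by (auto simp: path_between_def path_def)
  show "w \<in> set (root_path w)" using * last_in_set by metis
qed

lemma ancestor_iff: "w \<in> verts T \<Longrightarrow> ancestor T r a w \<longleftrightarrow> a \<in> set (root_path w)"
  using path_between_root_path root_path_eq by (auto simp: ancestor_def)

lemma root_path_prefix:
  assumes "w \<in> verts T" "a \<in> set (root_path w)"
  obtains zs where "root_path w = root_path a @ zs"
proof -
  obtain ys zs where "root_path w = ys @ a # zs" "path_between T r a (ys @ [a])"
    using path_between_prefix[OF path_between_root_path[OF assms(1)] assms(2)] .
  then show ?thesis using that[of zs] root_path_eq[of a "ys @ [a]"] by simp
qed

lemma root_path_snoc:
  assumes "{w, x} \<in> E" "x \<notin> set (root_path w)"
  shows "root_path x = root_path w @ [x]"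
proof -
  have w: "w \<in> verts T" "x \<in> verts T" using edge_verts assms(1) by auto
  note p = root_path_props[OF w(1)]
  have "path_between T r x (root_path w @ [x])"
    using p w assms by (auto simp: path_between_def path_def successively_append_iff)
  then show ?thesis by (rule root_path_eq)
qed

text \<open>Either \<open>x\<close> is off the path to \<open>w\<close> and extends it, or the path
  to \<open>x\<close> is a prefix of the path to \<open>w\<close> that avoids \<open>w\<close> and
  is extended by \<open>w\<close>.\<close>

lemma root_path_edge:
  assumes "{w, x} \<in> E"
  shows "root_path x = root_path w @ [x] \<or> root_path w = root_path x @ [w]"
proof (cases "x \<in> set (root_path w)")
  case True
  have wx: "w \<in> verts T" "x \<in> verts T" "w \<noteq> x" using edge_verts assms by auto
  obtain zs where zs: "root_path w = root_path x @ zs" using root_path_prefix wx True by blast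
  have "w \<notin> set (root_path x)"
  proof
    assume "w \<in> set (root_path x)"
    moreover have "zs \<noteq> []" using zs wx root_path_props(4)[of w] root_path_props(4)[of x] by auto
    then have "w \<in> set zs" using zs wx root_path_props(4)[of w] by (metis last_appendR last_in_set)
    ultimately show False using root_path_props(2)[OF wx(1)] zs by auto
  qed
  then show ?thesis using root_path_snoc[of x w] assms by (simp add: insert_commute)
qed (simp add: root_path_snoc assms)

lemma children_iff:
  "u \<in> children_of v \<longleftrightarrow> {v, u} \<in> E \<and> root_path u = root_path v @ [u]"
proof
  assume u: "u \<in> children_of v"
  then have *: "{v, u} \<in> E" "u \<in> verts T" "v \<in> set (root_path u)"
    by (auto simp: children_def ancestor_iff)
  then have "v \<in> verts T" using edge_verts by auto
  then have "root_path v \<noteq> root_path u @ [v]" using * root_path_props(2)[of v] by auto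
  then show "{v, u} \<in> E \<and> root_path u = root_path v @ [u]" using root_path_edge * by auto
next
  assume *: "{v, u} \<in> E \<and> root_path u = root_path v @ [u]"
  then have "v \<in> verts T" "u \<in> verts T" using edge_verts by auto
  then show "u \<in> children_of v" using * root_path_props(7)[of v]
    by (auto simp: children_def ancestor_iff)
qed

lemma subtree_iff: "w \<in> V\<^sub>s v \<longleftrightarrow> w \<in> verts T \<and> v \<in> set (root_path w)"
  by (auto simp: subtree_verts_def ancestor_iff)

lemma child_verts: "u \<in> children_of v \<Longrightarrow> u \<in> verts T \<and> v \<in> verts T"
  using edge_verts by (auto simp: children_iff)

lemma parent_child:
  assumes "u \<in> children_of v"
  shows "parent T r u = Some v"
proof -
  have uv: "u \<in> verts T" "v \<in> verts T" using child_verts assms by auto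
  have "u \<noteq> r"
  proof
    assume "u = r"
    then have "path_between T r u [u]" using uv by (simp add: path_between_def path_def)
    then have "root_path u = [u]" by (rule root_path_eq)
    then show False using assms root_path_props(1)[OF uv(2)] by (auto simp: children_iff)
  qed
  moreover have "v' = v" if "u \<in> children_of v'" for v'
    using that assms uv child_verts[OF that] by (metis append1_eq_conv children_iff root_path_props(4))
  then have "(THE w. u \<in> children_of w) = v" using assms by blast
  ultimately show ?thesis by (simp add: parent_def)
qed

text \<open>The definite description in \<open>parent\<close> denotes an actual parent: dropping the
  last vertex of the root path of \<open>v\<close> leaves the root path of a vertex that has
  \<open>v\<close> as a child.\<close>

lemma parent_Some_iff:
  assumes "v \<in> verts T"
  shows "parent T r v = Some q \<longleftrightarrow> v \<in> children_of q"
proof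
  assume q: "parent T r v = Some q"
  then have "v \<noteq> r" by (auto simp: parent_def split: if_splits)
  note p = root_path_props[OF assms]
  obtain ys where ys: "root_path v = ys @ [v]" using p by (metis append_butlast_last_id)
  then have ne: "ys \<noteq> []" using p(3) \<open>v \<noteq> r\<close> by auto
  have "successively (\<lambda>x y. {x, y} \<in> E) (ys @ [v])" using p(6) ys by simp
  then have s: "successively (\<lambda>x y. {x, y} \<in> E) ys" "{last ys, v} \<in> E"
    using ne unfolding successively_append_iff by auto
  have "path_between T r (last ys) ys"
    using p ys ne s by (auto simp: path_between_def path_def hd_append)
  then have "root_path (last ys) = ys" by (rule root_path_eq)
  then have "v \<in> children_of (last ys)" using ys s by (simp add: children_iff)
  moreover from parent_child[OF this] have "q = last ys" using q by simp
  ultimately show "v \<in> children_of q" by simp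
qed (rule parent_child)

section \<open>Boundary and decomposition of subtrees\<close>

text \<open>Root paths of adjacent vertices differ by one final vertex. If only the path to
  \<open>w\<close> contains \<open>v\<close>, that final vertex \<open>w\<close> is \<open>v\<close>
  itself and \<open>x\<close> is its parent.\<close>

lemma subtree_boundary:
  assumes "w \<in> V\<^sub>s v" "{w, x} \<in> E" "x \<notin> V\<^sub>s v"
  shows "w = v \<and> parent T r v = Some x"
proof -
  have x: "x \<in> verts T" using edge_verts assms by auto
  have v: "v \<in> set (root_path w)" "v \<notin> set (root_path x)" using assms x by (auto simp: subtree_iff)
  then have *: "root_path w = root_path x @ [w]" using root_path_edge[OF assms(2)] by auto
  then have "w = v" using v by auto
  moreover have "w \<in> children_of x" using * assms(2) by (simp add: children_iff insert_commute)
  ultimately show ?thesis using parent_child by auto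
qed

lemma nbrs_eq:
  assumes "v \<in> verts T"
  shows "nbrs E v = children_of v \<union> set_option (parent T r v)"
proof -
  have "{v, u} \<in> E \<longleftrightarrow> u \<in> children_of v \<or> v \<in> children_of u" for u
    using root_path_edge[of v u] by (auto simp: children_iff insert_commute)
  then show ?thesis using parent_Some_iff[OF assms] by (auto simp: nbrs_def)
qed

lemma subtree_self: "v \<in> verts T \<Longrightarrow> v \<in> V\<^sub>s v"
  using root_path_props(7) by (simp add: subtree_iff)

lemma parent_notin_subtree:
  assumes "v \<in> verts T" "parent T r v = Some q"
  shows "q \<notin> V\<^sub>s v"
  using assms root_path_props(2)[of v] by (auto simp: parent_Some_iff children_iff subtree_iff)

text \<open>The root path of a proper descendant of \<open>v\<close> continues beyond
  \<open>v\<close>, and the next vertex on it is a child of \<open>v\<close>.\<close>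

lemma subtree_decomp:
  assumes "v \<in> verts T"
  shows "V\<^sub>s v = insert v (\<Union>u\<in>children_of v. V\<^sub>s u)"
proof
  show "insert v (\<Union>u\<in>children_of v. V\<^sub>s u) \<subseteq> V\<^sub>s v"
    using child_subtree_verts_psubset[OF rooted_tree _ assms] subtree_self[OF assms] by blast
  show "V\<^sub>s v \<subseteq> insert v (\<Union>u\<in>children_of v. V\<^sub>s u)"
  proof
    fix w assume w: "w \<in> V\<^sub>s v"
    then have wv: "w \<in> verts T" "v \<in> set (root_path w)" by (auto simp: subtree_iff)
    obtain zs where zs: "root_path w = root_path v @ zs" using root_path_prefix[OF wv] .
    show "w \<in> insert v (\<Union>u\<in>children_of v. V\<^sub>s u)"
    proof (cases zs)
      case Nil
      then have "w = v" using zs root_path_props(4)[OF wv(1)] root_path_props(4)[OF assms]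
        by (metis append_Nil2)
      then show ?thesis by simp
    next
      case (Cons u us)
      have s: "successively (\<lambda>x y. {x, y} \<in> E) (root_path v @ u # us)"
        using root_path_props(6)[OF wv(1)] zs Cons by simp
      then have e: "{v, u} \<in> E"
        using root_path_props(1,4)[OF assms] by (simp add: successively_append_iff)
      moreover have "u \<notin> set (root_path v)"
        using root_path_props(2)[OF wv(1)] zs Cons by auto
      ultimately have "u \<in> children_of v" using root_path_snoc by (simp add: children_iff)
      moreover have "w \<in> V\<^sub>s u" using wv zs Cons by (simp add: subtree_iff)
      ultimately show ?thesis by auto
    qed
  qed
qed

lemma notin_child_subtree: "u \<in> children_of v \<Longrightarrow> v \<notin> V\<^sub>s u"
  using parent_notin_subtree parent_child child_verts by blast

text \<open>Both children occupy the position right after the root path of \<open>v\<close> on the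
  root path of \<open>w\<close>.\<close>

lemma child_subtrees_disjoint:
  assumes "u \<in> children_of v" "u' \<in> children_of v" "w \<in> V\<^sub>s u" "w \<in> V\<^sub>s u'"
  shows "u = u'"
proof -
  have w: "w \<in> verts T" "u \<in> set (root_path w)" "u' \<in> set (root_path w)"
    using assms by (auto simp: subtree_iff)
  obtain zs where zs: "root_path w = root_path u @ zs" using root_path_prefix[OF w(1,2)] .
  obtain zs' where zs': "root_path w = root_path u' @ zs'" using root_path_prefix[OF w(1,3)] .
  show ?thesis using zs zs' assms(1,2) by (simp add: children_iff)
qed

section \<open>Claw-deletion numbers of vertex sets\<close>

abbreviation ds :: "'a set \<Rightarrow> 'a set \<Rightarrow> bool" where
  "ds X S \<equiv> deletion_set X E (\<lambda>_. 0) S"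

text \<open>Working with vertex sets of \<open>T\<close> instead of subgraphs lets all deletion
  numbers refer to one fixed edge set.\<close>

definition cd :: "'a set \<Rightarrow> nat" where "cd X = cdn (induced T X)"

lemma cd_Least: "X \<subseteq> verts T \<Longrightarrow> cd X = (LEAST k. \<exists>S. ds X S \<and> card S = k)"
  by (simp add: cd_def cdn_def claw_deletion_set_induced_iff forest)

lemma cd_le: "X \<subseteq> verts T \<Longrightarrow> ds X S \<Longrightarrow> cd X \<le> card S"
  by (auto simp: cd_Least intro: Least_le)

lemma cd_witness:
  assumes "X \<subseteq> verts T"
  obtains S where "ds X S" "card S = cd X"
proof -
  \<comment> \<open>The whole set \<open>X\<close> is a deletion set, so the minimum is
    attained.\<close>
  have "\<exists>S. ds X S \<and> card S = card X" by (auto simp: deletion_set_def)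
  then have "\<exists>S. ds X S \<and> card S = cd X" unfolding cd_Least[OF assms] by (rule LeastI)
  then show ?thesis using that by auto
qed

lemma ds_finite: "ds X S \<Longrightarrow> X \<subseteq> verts T \<Longrightarrow> finite S"
  using deletion_set_subset_finite finite_verts finite_subset by metis

lemma cd_le_restrict:
  assumes "ds X S" "Y \<subseteq> X" "X \<subseteq> verts T"
  shows "cd Y \<le> card (S \<inter> Y)"
  using deletion_set_restrict[OF simple assms(1,2)] assms by (auto intro: cd_le)

lemma cd_mono:
  assumes "Y \<subseteq> X" "X \<subseteq> verts T"
  shows "cd Y \<le> cd X"
proof -
  obtain S where S: "ds X S" "card S = cd X" using cd_witness assms by blast
  have "cd Y \<le> card (S \<inter> Y)" using cd_le_restrict S assms by blast
  also have "\<dots> \<le> card S" using ds_finite[OF S(1) assms(2)] by (simp add: card_mono)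
  finally show ?thesis using S by simp
qed

lemma ds_insert: "ds X S \<Longrightarrow> ds (insert x X) (insert x S)"
proof -
  assume S: "ds X S"
  have "nbrs E v \<inter> insert x X - insert x S = nbrs E v \<inter> X - S - {x}" for v by auto
  moreover have "card (A - {x}) \<le> 2" if "card A \<le> 2" for A
    using that card_Diff1_le[of A x] by linarith
  ultimately show ?thesis using S by (auto simp: deletion_set_def)
qed

lemma cd_insert:
  assumes "insert x X \<subseteq> verts T"
  shows "cd (insert x X) \<le> Suc (cd X)"
proof -
  obtain S where S: "ds X S" "card S = cd X" using cd_witness assms by blast
  have "cd (insert x X) \<le> card (insert x S)" using cd_le[OF assms ds_insert[OF S(1)]] .
  also have "\<dots> \<le> Suc (card S)" by (rule card_insert_le_m1) auto
  finally show ?thesis using S by simp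
qed

lemma subtree_verts_subset: "V\<^sub>s v \<subseteq> verts T"
  by (auto simp: subtree_verts_def)

section \<open>Correctness of the recursive procedure\<close>

definition V\<^sub>p :: "'a \<Rightarrow> 'a set" where "V\<^sub>p v = V\<^sub>s v \<union> set_option (parent T r v)"

text \<open>The specification, used as induction hypothesis. The last two clauses select among the
  minimum deletion sets: if the parent is absent from \<open>S\<close>, attaching it does not raise
  the deletion number, and if \<open>v\<close> is absent as well, no minimum deletion set of
  \<open>V\<^sub>s v\<close> contains \<open>v\<close>.\<close>

definition good :: "'a \<Rightarrow> 'a set \<Rightarrow> bool" where
  "good v S \<longleftrightarrow> ds (V\<^sub>p v) S \<and> card S = cd (V\<^sub>p v) \<and>
     (cd (V\<^sub>p v) = 1 + cd (V\<^sub>s v) \<longrightarrow> parent T r v \<in> Some ` S) \<and>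
     (cd (V\<^sub>p v) = cd (V\<^sub>s v) \<and> cd (V\<^sub>s v) = 1 + cd (V\<^sub>s v - {v}) \<longrightarrow> v \<in> S)"

lemma V\<^sub>p_child: "u \<in> children_of v \<Longrightarrow> V\<^sub>p u = insert v (V\<^sub>s u)"
  by (simp add: V\<^sub>p_def parent_child)

lemma V\<^sub>p_subset: "v \<in> verts T \<Longrightarrow> V\<^sub>p v \<subseteq> verts T"
  using subtree_verts_subset child_verts parent_Some_iff by (auto simp: V\<^sub>p_def)

text \<open>What the parent \<open>v\<close> learns from the set of its child \<open>u\<close>.
  Attaching \<open>v\<close> raises the deletion number of the subtree by at most one, so
  \<open>S\<close> without \<open>v\<close> is still minimum there. The last fact means that
  deleting a child outside \<open>S\<close> saves nothing in its subtree.\<close>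

lemma good_child:
  assumes u: "u \<in> children_of v" and S: "good u S"
  shows "card (S - {v}) = cd (V\<^sub>s u)" "ds (V\<^sub>s u) (S - {v})"
    "v \<in> S \<Longrightarrow> cd (insert v (V\<^sub>s u)) = Suc (cd (V\<^sub>s u))"
    "v \<notin> S \<Longrightarrow> u \<notin> S \<Longrightarrow> cd (V\<^sub>s u - {u}) = cd (V\<^sub>s u)"
proof -
  let ?X = "V\<^sub>s u" and ?Y = "insert v (V\<^sub>s u)"
  have uv: "u \<in> verts T" "v \<in> verts T" using child_verts u by auto
  have Y: "?Y \<subseteq> verts T" using uv subtree_verts_subset by auto
  have S': "ds ?Y S" "card S = cd ?Y" "cd ?Y = 1 + cd ?X \<Longrightarrow> v \<in> S"
    "cd ?Y = cd ?X \<Longrightarrow> cd ?X = 1 + cd (?X - {u}) \<Longrightarrow> u \<in> S"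
    using S u by (auto simp: good_def V\<^sub>p_child parent_child)
  have fin: "finite S" using ds_finite S' Y by blast
  have SX: "S \<inter> ?X = S - {v}" using S'(1) notin_child_subtree[OF u] by (auto simp: deletion_set_def)
  show ds: "ds ?X (S - {v})"
    using deletion_set_restrict[OF simple S'(1), of ?X] SX by auto
  have 1: "cd ?X \<le> card (S - {v})" using cd_le[OF subtree_verts_subset ds] .
  have 2: "cd ?Y \<le> Suc (cd ?X)" using cd_insert[OF Y] .
  have 3: "v \<in> S \<Longrightarrow> Suc (card (S - {v})) = card S" using fin by (metis card.remove)
  have 4: "cd ?X \<le> cd ?Y" by (rule cd_mono[OF subset_insertI Y])
  show "card (S - {v}) = cd ?X"
  proof (cases "v \<in> S")
    case True
    then show ?thesis using 1 2 3 S'(2) by simp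
  next
    case False
    then have "cd ?Y \<noteq> Suc (cd ?X)" using S'(3) by auto
    then show ?thesis using 2 4 S'(2) False by simp
  qed
  then show "v \<in> S \<Longrightarrow> cd ?Y = Suc (cd ?X)" using 3 S' by simp
  have "cd (?X - {u}) \<le> cd ?X" by (rule cd_mono[OF Diff_subset subtree_verts_subset])
  moreover have "insert u (?X - {u}) = ?X" using subtree_self uv by auto
  then have "cd ?X \<le> Suc (cd (?X - {u}))" using cd_insert[of u "?X - {u}"] subtree_verts_subset by auto
  ultimately show "cd (?X - {u}) = cd ?X" if "v \<notin> S" "u \<notin> S"
    using that S'(3,4) 2 4 by linarith
qed

text \<open>\<open>U\<close> collects the sets of the children, and \<open>c\<close> counts the
  children that \<open>U\<close> keeps. Each branch pairs feasibility, obtained from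
  \<open>ds_Z\<close>, with a lower bound of \<open>A\<close> or \<open>Suc A\<close>.\<close>

lemma good_step:
  assumes v: "v \<in> verts T" and F: "\<And>u. u \<in> children_of v \<Longrightarrow> good u (F u)"
  defines "U \<equiv> (\<Union>u\<in>children_of v. F u)"
  defines "c \<equiv> card (children_of v - U)"
  shows "good v (if 3 \<le> c then U \<union> {v}
     else if c = 2 \<and> parent T r v \<noteq> None \<and> v \<notin> U then U \<union> {the (parent T r v)} else U)"
    (is "good v ?S")
proof -
  let ?C = "children_of v" and ?X = "V\<^sub>s v" and ?Y = "V\<^sub>p v" and ?N = "nbrs E v"
  define A where "A = (\<Sum>u\<in>?C. cd (V\<^sub>s u))"
  have finC: "finite ?C" using finite_verts by (auto simp: children_def)
  have XY: "?X \<subseteq> ?Y" "?Y \<subseteq> verts T" using V\<^sub>p_subset[OF v] by (auto simp: V\<^sub>p_def)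
  have vX: "v \<in> ?X" by (rule subtree_self[OF v])
  have Xv: "?X - {v} = (\<Union>u\<in>?C. V\<^sub>s u)"
    using subtree_decomp[OF v] notin_child_subtree by auto
  have dj: "V\<^sub>s u \<inter> V\<^sub>s u' = {}" if "u \<in> ?C" "u' \<in> ?C" "u \<noteq> u'" for u u'
    using child_subtrees_disjoint that by blast
  have finV: "finite (V\<^sub>s u)" for u using finite_subset[OF subtree_verts_subset finite_verts] .
  have cC: "u \<in> V\<^sub>s u" if "u \<in> ?C" for u using subtree_self child_verts that by blast
  have sum_card: "card (S - {v}) \<ge> (\<Sum>u\<in>?C. card (S \<inter> V\<^sub>s u))" if "finite S" for S
  proof -
    have "(\<Sum>u\<in>?C. card (S \<inter> V\<^sub>s u)) = card (\<Union>u\<in>?C. S \<inter> V\<^sub>s u)"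
      using finC finV dj by (intro card_UN_disjoint[symmetric]) auto
    also have "\<dots> \<le> card (S - {v})"
      using that notin_child_subtree by (intro card_mono) auto
    finally show ?thesis .
  qed
  have FD: "ds (insert v (V\<^sub>s u)) (F u)" if "u \<in> ?C" for u
    using F[OF that] by (simp add: good_def V\<^sub>p_child[OF that])
  have FS: "F u \<subseteq> insert v (V\<^sub>s u)" if "u \<in> ?C" for u
    using FD[OF that] by (simp add: deletion_set_def)
  \<comment> \<open>The sets returned for different children overlap at most in \<open>v\<close>, so
    inside one child subtree \<open>U\<close> is just the set of that child.\<close>
  have UV: "U \<inter> V\<^sub>s u = F u - {v}" if "u \<in> ?C" for u
    using FS dj that notin_child_subtree[OF that] unfolding U_def by blast
  have UX: "U \<subseteq> ?X" using FS vX Xv unfolding U_def by auto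
  have finU: "finite U" using UX finV finite_subset by blast
  have cardU: "card (U - {v}) = A"
  proof -
    have "U - {v} = (\<Union>u\<in>?C. U \<inter> V\<^sub>s u)" using UX Xv by auto
    also have "card \<dots> = (\<Sum>u\<in>?C. card (U \<inter> V\<^sub>s u))"
      using finC finV dj by (intro card_UN_disjoint) auto
    also have "\<dots> = A" unfolding A_def using UV good_child(1) F by (intro sum.cong) auto
    finally show ?thesis .
  qed
  have sum_lower: "A \<le> (\<Sum>u\<in>?C. card (S \<inter> V\<^sub>s u))"
    if "ds Z S" "?X - {v} \<subseteq> Z" "Z \<subseteq> verts T" for Z S
    unfolding A_def
  proof (rule sum_mono)
    fix u assume "u \<in> ?C"
    then have "V\<^sub>s u \<subseteq> Z" using that Xv by auto
    then show "cd (V\<^sub>s u) \<le> card (S \<inter> V\<^sub>s u)" using cd_le_restrict that by auto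
  qed
  \<comment> \<open>A deleted vertex outside all child subtrees, be it \<open>v\<close> or its
    parent, comes on top of the \<open>A\<close> deletions that these subtrees require.\<close>
  have lower_v: "Suc A \<le> card S" if "ds Z S" "?X \<subseteq> Z" "Z \<subseteq> verts T" "x \<in> S - \<Union> (V\<^sub>s ` ?C)" for Z S x
  proof -
    have fin: "finite S" using ds_finite that by blast
    have "A \<le> (\<Sum>u\<in>?C. card (S \<inter> V\<^sub>s u))" using sum_lower that by blast
    also have "\<dots> = card (\<Union>u\<in>?C. S \<inter> V\<^sub>s u)"
      using finC finV dj by (intro card_UN_disjoint[symmetric]) auto
    also have "\<dots> \<le> card (S - {x})"
      using that fin by (intro card_mono) auto
    also have "Suc \<dots> = card S" using that fin by (metis DiffD1 card.remove)
    finally show ?thesis by simp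
  qed
  have vnot: "v \<notin> \<Union> (V\<^sub>s ` ?C)" using notin_child_subtree by auto
  have cd_Xv: "cd (?X - {v}) = A"
  proof (rule antisym)
    have "ds (?X - {v}) (U - {v})"
      unfolding deletion_set_def
    proof (intro conjI ballI)
      show "U - {v} \<subseteq> ?X - {v}" using UX by auto
      fix w assume w: "w \<in> ?X - {v} - (U - {v})"
      then obtain u where u: "u \<in> ?C" "w \<in> V\<^sub>s u" using Xv by auto
      \<comment> \<open>With \<open>v\<close> removed, no edge leaves the subtree of
        \<open>u\<close>.\<close>
      have "nbrs E w \<inter> (?X - {v}) - (U - {v}) \<subseteq> nbrs E w \<inter> V\<^sub>s u - (F u - {v})"
        using subtree_boundary[OF u(2)] parent_child[OF u(1)] u UV[OF u(1)] by (auto simp: nbrs_def)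
      then have "card (nbrs E w \<inter> (?X - {v}) - (U - {v})) \<le> card (nbrs E w \<inter> V\<^sub>s u - (F u - {v}))"
        using finite_nbrs[OF simple] by (intro card_mono) auto
      also have "\<dots> \<le> 2" using good_child(2)[OF u(1) F[OF u(1)]] u w UV[OF u(1)]
        by (auto simp: deletion_set_def)
      finally show "0 + card (nbrs E w \<inter> (?X - {v}) - (U - {v})) \<le> 2" by simp
    qed
    then have "cd (?X - {v}) \<le> card (U - {v})" by (intro cd_le) (use subtree_verts_subset in auto)
    then show "cd (?X - {v}) \<le> A" using cardU by simp
    obtain S where S: "ds (?X - {v}) S" "card S = cd (?X - {v})"
      using cd_witness subtree_verts_subset by (metis Diff_subset order_trans)
    have "A \<le> (\<Sum>u\<in>?C. card (S \<inter> V\<^sub>s u))"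
      using sum_lower[OF S(1)] subtree_verts_subset by blast
    also have "\<dots> \<le> card (S - {v})"
      using sum_card ds_finite S subtree_verts_subset by (metis Diff_subset order_trans)
    also have "S - {v} = S" using S by (auto simp: deletion_set_def)
    finally show "A \<le> cd (?X - {v})" using S by simp
  qed
  \<comment> \<open>Inside the subtree of \<open>u\<close> the set \<open>F u\<close> already
    accounts for the edge from \<open>u\<close> to \<open>v\<close>, and the parent of
    \<open>v\<close> has no neighbour but \<open>v\<close> in \<open>Z\<close>. Hence only the
    degree of \<open>v\<close> remains to be checked.\<close>
  have ds_Z: "ds Z S" if Z: "?X \<subseteq> Z" "Z \<subseteq> ?Y" and S: "U \<subseteq> S" "S \<subseteq> Z"
    and vS: "v \<in> S \<or> card (?N \<inter> Z - S) \<le> 2" for Z S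
    unfolding deletion_set_def
  proof (intro conjI ballI)
    show "S \<subseteq> Z" by fact
    fix w assume w: "w \<in> Z - S"
    consider "w = v" | u where "u \<in> ?C" "w \<in> V\<^sub>s u" | "w \<notin> ?X"
      using Xv by blast
    then show "0 + card (nbrs E w \<inter> Z - S) \<le> 2"
    proof cases
      case 1
      then show ?thesis using vS w by auto
    next
      case 2
      have "nbrs E w \<inter> Z - S \<subseteq> nbrs E w \<inter> insert v (V\<^sub>s u) - F u"
        using subtree_boundary[OF 2(2)] parent_child[OF 2(1)] S 2(1) unfolding U_def nbrs_def by auto
      then have "card (nbrs E w \<inter> Z - S) \<le> card (nbrs E w \<inter> insert v (V\<^sub>s u) - F u)"
        using finite_nbrs[OF simple] by (intro card_mono) auto
      also have "\<dots> \<le> 2" 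
      proof -
        have "w \<in> insert v (V\<^sub>s u) - F u" using 2 S w by (auto simp: U_def)
        then show ?thesis using FD[OF 2(1)] by (simp add: deletion_set_def)
      qed
      finally show ?thesis by simp
    next
      case 3
      then have p: "parent T r v = Some w" using w Z by (auto simp: V\<^sub>p_def)
      have "nbrs E w \<inter> Z \<subseteq> {v}"
      proof
        fix x assume x: "x \<in> nbrs E w \<inter> Z"
        then have "x \<noteq> w" using self_notin_nbrs[OF simple] by auto
        then have "x \<in> ?X" using x Z p by (auto simp: V\<^sub>p_def)
        then show "x \<in> {v}" using subtree_boundary[of x v w] x 3 by (auto simp: nbrs_def insert_commute)
      qed
      then have "card (nbrs E w \<inter> Z - S) \<le> card {v}" by (intro card_mono) auto
      then show ?thesis by simp
    qed
  qed
  have cd_XY: "cd ?X \<le> cd ?Y" by (rule cd_mono[OF XY])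
  show ?thesis
  proof (cases "v \<in> U")
    case True
    then obtain u where u: "u \<in> ?C" "v \<in> F u" by (auto simp: U_def)
    \<comment> \<open>Either \<open>v\<close> is deleted, on top of the \<open>A\<close> deletions
      below it, or it is kept and the subtree of \<open>u\<close> needs one deletion more than its
      own minimum.\<close>
    have low: "Suc A \<le> cd ?X"
    proof -
      obtain S where S: "ds ?X S" "card S = cd ?X" using cd_witness subtree_verts_subset by blast
      show ?thesis
      proof (cases "v \<in> S")
        case True
        then show ?thesis using lower_v[OF S(1), of v] S(2) vnot subtree_verts_subset by auto
      next
        case False
        have sub: "insert v (V\<^sub>s u) \<subseteq> ?X" "V\<^sub>s u \<subseteq> ?X" using u vX Xv by auto
        have "S \<inter> insert v (V\<^sub>s u) = S \<inter> V\<^sub>s u" using False by auto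
        then have "Suc (cd (V\<^sub>s u)) \<le> card (S \<inter> V\<^sub>s u)"
          using cd_le_restrict[OF S(1) sub(1) subtree_verts_subset] good_child(3)[OF u(1) F[OF u(1)] u(2)] by simp
        moreover have "cd (V\<^sub>s w) \<le> card (S \<inter> V\<^sub>s w)" if "w \<in> ?C" for w
          using cd_le_restrict[OF S(1) _ subtree_verts_subset] that Xv by blast
        ultimately have "A < (\<Sum>u\<in>?C. card (S \<inter> V\<^sub>s u))"
          unfolding A_def using u finC
          by (intro sum_strict_mono_ex1) (auto simp: less_eq_Suc_le intro!: bexI[of _ u])
        also have "\<dots> \<le> card (S - {v})"
          using sum_card ds_finite S subtree_verts_subset by blast
        also have "S - {v} = S" using False by auto
        finally show ?thesis using S by simp
      qed
    qed
    \<comment> \<open>Adding \<open>v\<close> changes nothing, and the parent is only added for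
      \<open>v \<notin> U\<close>, so every branch returns \<open>U\<close>.\<close>
    have S: "?S = U" using True by auto
    have "ds ?Y U" using ds_Z[of ?Y U] XY UX True by auto
    moreover have "card U = Suc A" using cardU True finU by (metis card.remove)
    moreover have "cd ?Y \<le> card U" using cd_le[OF XY(2) calculation(1)] .
    ultimately show ?thesis unfolding S using low cd_XY True cd_Xv by (simp add: good_def)
  next
    case False
    have U: "card U = A" using cardU False by simp
    have notU: "cd (V\<^sub>s u - {u}) = cd (V\<^sub>s u)" if "u \<in> ?C - U" for u
      using good_child(4)[of u v "F u"] F that False by (auto simp: U_def)
    \<comment> \<open>A deletion set of size A restricts to a minimum one in every child subtree, and a
      minimum one contains no child outside U, as the rest would be too small.\<close>
    have crowded: "Suc A \<le> card S"
      if S: "ds Z S" and Z: "?X \<subseteq> Z" "Z \<subseteq> ?Y" and N: "3 \<le> card (?C - U \<union> (Z - ?X))" for Z S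
    proof (rule ccontr)
      assume "\<not> ?thesis"
      then have cS: "card S \<le> A" by simp
      have ZV: "Z \<subseteq> verts T" using Z XY by auto
      have fin: "finite S" using ds_finite S ZV by blast
      have out: "S \<subseteq> \<Union> (V\<^sub>s ` ?C)" using lower_v[OF S Z(1) ZV] cS by fastforce
      then have vS: "v \<notin> S" using vnot by auto
      have le: "cd (V\<^sub>s u) \<le> card (S \<inter> V\<^sub>s u)" if "u \<in> ?C" for u
        using cd_le_restrict[OF S _ ZV, of "V\<^sub>s u"] that Xv Z by blast
      have "(\<Sum>u\<in>?C. card (S \<inter> V\<^sub>s u)) \<le> A" using sum_card[OF fin] vS cS by simp
      \<comment> \<open>Termwise lower bounds whose sum is already \<open>A\<close> leave no slack
        in any child subtree.\<close>
      then have eq: "card (S \<inter> V\<^sub>s u) = cd (V\<^sub>s u)" if "u \<in> ?C" for u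
        using that le sum_strict_mono_ex1[OF finC, of "\<lambda>u. cd (V\<^sub>s u)" "\<lambda>u. card (S \<inter> V\<^sub>s u)"]
        unfolding A_def by (metis le_antisym not_le leI order_le_less)
      have "u \<notin> S" if u: "u \<in> ?C - U" for u
      proof
        assume "u \<in> S"
        then have "card (S \<inter> V\<^sub>s u) = Suc (card (S \<inter> (V\<^sub>s u - {u})))"
          using cC u fin card.remove[of "S \<inter> V\<^sub>s u" u]
          by (auto simp: Diff_Int_distrib)
        moreover have "cd (V\<^sub>s u - {u}) \<le> card (S \<inter> (V\<^sub>s u - {u}))"
          using cd_le_restrict[OF S _ ZV, of "V\<^sub>s u - {u}"] u Xv Z by blast
        ultimately show False using eq notU u by auto
      qed
      moreover have "?C - U \<subseteq> Z" using cC Xv Z by auto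
      moreover have "Z - ?X \<subseteq> ?N" using Z nbrs_eq[OF v] by (auto simp: V\<^sub>p_def)
      moreover have "(Z - ?X) \<inter> S = {}" using out Xv by auto
      ultimately have "?C - U \<union> (Z - ?X) \<subseteq> ?N \<inter> Z - S" using nbrs_eq[OF v] by blast
      then have "3 \<le> card (?N \<inter> Z - S)"
        using N card_mono[of "?N \<inter> Z - S"] finite_nbrs[OF simple] by (meson finite_Diff finite_Int le_trans)
      moreover have "v \<in> Z - S" using vS vX Z by auto
      then have "card (?N \<inter> Z - S) \<le> 2" using S by (simp add: deletion_set_def)
      ultimately show False by simp
    qed
    have C_U: "?N \<inter> Z - U \<subseteq> (?C - U) \<union> set_option (parent T r v)" for Z using nbrs_eq[OF v] by auto
    have finP: "finite ((?C - U) \<union> set_option (parent T r v))" using finC by simp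
    consider "3 \<le> c" | q where "c = 2" "parent T r v = Some q" | "c < 3" "c = 2 \<Longrightarrow> parent T r v = None"
      by (metis not_le not_None_eq)
    then show ?thesis
    proof cases
      case 1
      then have S: "?S = insert v U" by auto
      have "ds ?Y (insert v U)" using ds_Z[of ?Y "insert v U"] XY UX vX by auto
      moreover have "card (insert v U) = Suc A" using U finU False by simp
      moreover have "cd ?Y \<le> card (insert v U)" using cd_le[OF XY(2) calculation(1)] .
      \<comment> \<open>Three kept children crowd \<open>v\<close> even without the parent, so the
        subtree itself costs \<open>Suc A\<close>; this is the case in which \<open>good\<close>
        asks for \<open>v\<close>.\<close>
      moreover obtain S where "ds ?X S" "card S = cd ?X" using cd_witness subtree_verts_subset by blast
      then have "Suc A \<le> cd ?X" using crowded[of ?X S] XY 1 by (simp add: c_def)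
      ultimately show ?thesis unfolding S using cd_XY cd_Xv by (simp add: good_def)
    next
      case 2
      \<comment> \<open>Two kept children are harmless within the subtree, but the parent is a third
        kept neighbour: \<open>cd ?X\<close> is at most \<open>A\<close>, while \<open>cd ?Y\<close>
        is \<open>Suc A\<close> and is attained by deleting \<open>q\<close>.\<close>
      then have S: "?S = insert q U" using False by auto
      have q: "q \<notin> ?X" "q \<in> ?Y" "?Y - ?X = {q}"
        using parent_notin_subtree[OF v] 2 by (auto simp: V\<^sub>p_def)
      have "card (?C - U) \<le> 2" "card (?N \<inter> ?X - U) \<le> 2" "card (?N \<inter> ?Y - insert q U) \<le> 2"
      proof -
        show *: "card (?C - U) \<le> 2" using 2 c_def by simp
        have "?N \<inter> ?X - U \<subseteq> ?C - U" "?N \<inter> ?Y - insert q U \<subseteq> ?C - U"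
          using nbrs_eq[OF v] 2 q by auto
        then show "card (?N \<inter> ?X - U) \<le> 2" "card (?N \<inter> ?Y - insert q U) \<le> 2"
          using * finC by (meson card_mono finite_Diff le_trans)+
      qed
      then have "ds ?Y (insert q U)" "ds ?X U"
        using ds_Z[of ?Y "insert q U"] ds_Z[of ?X U] XY UX q by auto
      moreover have "q \<notin> U" using q UX by auto
      then have "card (insert q U) = Suc A" using U finU by simp
      moreover have "cd ?Y \<le> card (insert q U)" using cd_le[OF XY(2) calculation(1)] .
      moreover have "cd ?X \<le> A" using cd_le[OF subtree_verts_subset calculation(2)] U by simp
      moreover obtain S where S': "ds ?Y S" "card S = cd ?Y" using cd_witness XY by blast
      moreover have "card (?C - U \<union> (?Y - ?X)) = 3"
      proof -
        have "q \<notin> ?C" using q cC Xv by blast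
        then show ?thesis using q(3) 2 finC by (simp add: c_def)
      qed
      then have "Suc A \<le> cd ?Y" using crowded[OF S'(1) XY(1)] S'(2) by simp
      ultimately show ?thesis unfolding S using 2 by (simp add: good_def)
    next
      case 3
      then have S: "?S = U" by auto
      \<comment> \<open>Here \<open>v\<close> keeps at most two neighbours even with the parent:
        either there is no parent, or \<open>c \<le> 1\<close>.\<close>
      have "card (?C - U \<union> set_option (parent T r v)) \<le> 2"
      proof (cases "parent T r v")
        case None
        then show ?thesis using 3 c_def by simp
      next
        case (Some q)
        then have "c \<noteq> 2" using 3 by auto
        then have "card (?C - U) \<le> 1" using 3(1) c_def by linarith
        then show ?thesis using Some finC card_insert_le_m1[of 2 "?C - U" q] by simp
      qed
      then have "card (?N \<inter> ?Y - U) \<le> 2" using C_U finP by (meson card_mono le_trans)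
      then have "ds ?Y U" using ds_Z[of ?Y U] XY UX by auto
      moreover have "cd ?Y \<le> A" using cd_le[OF XY(2) calculation(1)] U by simp
      moreover have "A \<le> cd ?X" using cd_Xv cd_mono[OF Diff_subset subtree_verts_subset] by metis
      ultimately show ?thesis unfolding S using cd_XY U cd_Xv by (simp add: good_def)
    qed
  qed
qed

text \<open>Induction on the size of the subtree; the argument \<open>Some v\<close> of the
  recursive call is the parent of the child, as \<open>good\<close> expects.\<close>

lemma proc_good: "v \<in> verts T \<Longrightarrow> good v (claw_deletion_set_proc T r v (parent T r v))"
proof (induction "card (V\<^sub>s v)" arbitrary: v rule: less_induct)
  case less
  let ?F = "\<lambda>u. claw_deletion_set_proc T r u (Some v)"
  have "good u (?F u)" if u: "u \<in> children_of v" for u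
  proof -
    have "card (V\<^sub>s u) < card (V\<^sub>s v)"
      using child_subtree_verts_psubset[OF rooted_tree u less.prems] finite_subset[OF subtree_verts_subset finite_verts]
      by (simp add: psubset_card_mono)
    then show ?thesis using less.hyps[of u] child_verts[OF u] parent_child[OF u] by simp
  qed
  from good_step[OF less.prems this] show ?case
    using less.prems rooted_tree
    by (subst claw_deletion_set_proc.simps) (auto simp: Let_def)
qed

end

lemma claw_deletion_set_proc_correct:
  assumes "rooted_tree T r" "v \<in> verts T" "p = parent T r v" "S = claw_deletion_set_proc T r v p"
  shows "min_claw_deletion_set (subtree_plus T r v) S"
    "cdn (subtree_plus T r v) = 1 + cdn (subtree T r v) \<Longrightarrow> p \<in> Some ` S"
    "cdn (subtree_plus T r v) = cdn (subtree T r v) \<Longrightarrow>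
     cdn (subtree T r v) = 1 + cdn (delete_verts (subtree T r v) {v}) \<Longrightarrow> v \<in> S"
proof -
  interpret rooted T r by unfold_locales fact
  have "good v S" using proc_good assms by simp
  moreover have "subtree_plus T r v = induced T (V\<^sub>p v)" "subtree T r v = induced T (V\<^sub>s v)"
    "delete_verts (subtree T r v) {v} = induced T (V\<^sub>s v - {v})"
    by (simp_all add: subtree_plus_def V\<^sub>p_def subtree_def delete_verts_induced subtree_verts_subset)
  ultimately show "min_claw_deletion_set (subtree_plus T r v) S"
    "cdn (subtree_plus T r v) = 1 + cdn (subtree T r v) \<Longrightarrow> p \<in> Some ` S"
    "cdn (subtree_plus T r v) = cdn (subtree T r v) \<Longrightarrow>
     cdn (subtree T r v) = 1 + cdn (delete_verts (subtree T r v) {v}) \<Longrightarrow> v \<in> S"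
    using assms claw_deletion_set_induced_iff[OF forest V\<^sub>p_subset[OF assms(2)]]
    by (simp_all add: good_def cd_def min_claw_deletion_set_def)
qed

section \<open>Peeling leaves\<close>

text \<open>The value 3 stands for forced deletion: it exceeds the bound 2 whatever neighbours
  remain.\<close>

definition leaf_weight :: "nat \<Rightarrow> nat" where
  "leaf_weight c = (if 3 \<le> c then 0 else if c = 2 then 3 else 1)"

text \<open>An exchange argument. If a leaf \<open>v\<close> of weight at most 2 is deleted while
  \<open>p\<close> is kept, deleting \<open>p\<close> instead is at least as good. Otherwise the
  same set serves after peeling, since \<open>leaf_weight\<close> replaces the effect of
  \<open>v\<close> on \<open>p\<close>; in the converse direction the same set always
  serves.\<close>

lemma deletion_set_peel_leaf:
  assumes V: "finite V" "v \<in> V" "p \<in> V" "v \<noteq> p" and leaf: "nbrs E v = {p}"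
  shows "(\<exists>S. deletion_set V E w S \<and> card S \<le> k) \<longleftrightarrow>
    (\<exists>S. deletion_set V (E - {{v, p}}) (w(p := w p + leaf_weight (w v))) S \<and> card S \<le> k)"
    (is "?L \<longleftrightarrow> ?R")
proof -
  let ?E = "E - {{v, p}}" and ?w = "w(p := w p + leaf_weight (w v))"
  have vp: "v \<in> nbrs E p" using leaf nbrs_sym[of p E v] by auto
  have nv: "nbrs ?E v = {}" using leaf by (auto simp: nbrs_def)
  have np: "nbrs ?E p = nbrs E p - {v}" by (auto simp: nbrs_def doubleton_eq_iff)
  have nx: "nbrs ?E x = nbrs E x" if "x \<noteq> v" "x \<noteq> p" for x
    using that by (auto simp: nbrs_def doubleton_eq_iff)
  have vx: "v \<notin> nbrs E x" if "x \<noteq> p" for x using that leaf nbrs_sym[of v E x] by auto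
  have cp: "card (nbrs E p \<inter> V - S) = Suc (card (nbrs ?E p \<inter> V - S))" if "v \<notin> S" for S
  proof -
    have "nbrs E p \<inter> V - S = insert v (nbrs ?E p \<inter> V - S)" using that V vp np by auto
    then show ?thesis using V np by simp
  qed
  have cp': "nbrs E p \<inter> V - S = nbrs ?E p \<inter> V - S" if "v \<in> S" for S
    using that np by auto
  show ?thesis
  proof
    assume ?L
    then obtain S where S: "S \<subseteq> V" "\<And>x. x \<in> V - S \<Longrightarrow> w x + card (nbrs E x \<inter> V - S) \<le> 2" "card S \<le> k"
      by (auto simp: deletion_set_def)
    have finS: "finite S" using S V finite_subset by blast
    show ?R
    proof (cases "v \<in> S \<and> p \<notin> S \<and> w v \<le> 2")
      case True
      let ?S = "insert p (S - {v})"
      have "?w x + card (nbrs ?E x \<inter> V - ?S) \<le> 2" if x: "x \<in> V - ?S" for x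
      proof (cases "x = v")
        case True
        then show ?thesis using nv V \<open>v \<in> S \<and> p \<notin> S \<and> w v \<le> 2\<close> by simp
      next
        case False
        then have "nbrs ?E x \<inter> V - ?S \<subseteq> nbrs E x \<inter> V - S" using x nx vx by auto
        then have "card (nbrs ?E x \<inter> V - ?S) \<le> card (nbrs E x \<inter> V - S)"
          using V by (intro card_mono) auto
        then show ?thesis using S(2)[of x] x False by auto
      qed
      moreover have "card ?S \<le> card S" using True finS card_Suc_Diff1[OF finS, of v] by simp
      moreover have "?S \<subseteq> V" using S(1) V by auto
      ultimately show ?thesis using S(3) unfolding deletion_set_def by (meson le_trans)
    next
      case False
      have "?w x + card (nbrs ?E x \<inter> V - S) \<le> 2" if x: "x \<in> V - S" for x
      proof -
        consider "x = v" | "x = p" "v \<in> S" | "x = p" "v \<notin> S" | "x \<noteq> v" "x \<noteq> p" by blast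
        then show ?thesis
        proof cases
          case 1
          then show ?thesis using S(2)[OF x] V nv by simp
        next
          case 2
          \<comment> \<open>The exchange case being excluded, the deleted leaf has weight at least 3
            and adds nothing to \<open>p\<close>.\<close>
          then have "3 \<le> w v" using False x by auto
          then show ?thesis using S(2)[OF x] 2 cp' by (simp add: leaf_weight_def)
        next
          case 3
          \<comment> \<open>Both ends are kept, so \<open>v\<close> has the kept neighbour
            \<open>p\<close> and weight at most 1; the increment 1 replaces the lost neighbour
            \<open>v\<close> of \<open>p\<close>.\<close>
          have "nbrs E v \<inter> V - S = {p}" using leaf V 3 x by auto
          then have "w v \<le> 1" using S(2)[of v] V 3 by auto
          then show ?thesis using S(2)[OF x] 3 cp by (simp add: leaf_weight_def)
        next
          case 4
          then show ?thesis using S(2)[OF x] nx by simp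
        qed
      qed
      then have "deletion_set V ?E ?w S" using S(1) unfolding deletion_set_def by blast
      then show ?thesis using S(3) by blast
    qed
  next
    assume ?R
    then obtain S where S: "S \<subseteq> V" "\<And>x. x \<in> V - S \<Longrightarrow> ?w x + card (nbrs ?E x \<inter> V - S) \<le> 2" "card S \<le> k"
      by (auto simp: deletion_set_def)
    have "w x + card (nbrs E x \<inter> V - S) \<le> 2" if x: "x \<in> V - S" for x
    proof -
      consider "x = v" | "x = p" "v \<in> S" | "x = p" "v \<notin> S" | "x \<noteq> v" "x \<noteq> p" by blast
      then show ?thesis
      proof cases
        case 1
        then have wv: "w v \<le> 2" using S(2)[OF x] V by auto
        show ?thesis
        proof (cases "p \<in> S")
          case True
          then have "card (nbrs E v \<inter> V - S) = 0" using leaf by auto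
          then show ?thesis using 1 wv by simp
        next
          case False
          \<comment> \<open>Weight 2 at \<open>v\<close> would have pushed \<open>p\<close> to
            weight at least 3 and forced its deletion.\<close>
          then have "w v \<noteq> 2" using S(2)[of p] V by (auto simp: leaf_weight_def)
          moreover have "nbrs E v \<inter> V - S = {p}" using leaf V False by auto
          ultimately show ?thesis using 1 wv by simp
        qed
      next
        case 2
        then show ?thesis using S(2)[OF x] cp' by simp
      next
        case 3
        then have "w v \<le> 2" using S(2)[of v] V by auto
        then have "1 \<le> leaf_weight (w v)" by (simp add: leaf_weight_def)
        then show ?thesis using S(2)[OF x] 3 cp by simp
      next
        case 4
        then show ?thesis using S(2)[OF x] nx by simp
      qed
    qed
    then have "deletion_set V E w S" using S(1) unfolding deletion_set_def by blast
    then show ?L using S(3) by blast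
  qed
qed

text \<open>Without edges a vertex violates the bound only through its own weight, so the vertices
  of weight at least 3 form the least deletion set.\<close>

lemma deletion_set_edgeless_iff:
  assumes "finite V"
  shows "(\<exists>S. deletion_set V {} w S \<and> card S \<le> k) \<longleftrightarrow> card {v \<in> V. 3 \<le> w v} \<le> k"
proof
  assume "\<exists>S. deletion_set V {} w S \<and> card S \<le> k"
  then obtain S where S: "deletion_set V {} w S" "card S \<le> k" by auto
  have "{v \<in> V. 3 \<le> w v} \<subseteq> S"
  proof
    fix v assume v: "v \<in> {v \<in> V. 3 \<le> w v}"
    show "v \<in> S"
    proof (rule ccontr)
      assume "v \<notin> S"
      then have "w v + card (nbrs {} v \<inter> V - S) \<le> 2" using S(1) v unfolding deletion_set_def by blast
      then show False using v by simp
    qed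
  qed
  moreover have "finite S" using S assms by (auto simp: deletion_set_def intro: finite_subset)
  ultimately show "card {v \<in> V. 3 \<le> w v} \<le> k" using S(2) card_mono le_trans by blast
next
  have "deletion_set V {} w {v \<in> V. 3 \<le> w v}" by (auto simp: deletion_set_def nbrs_def)
  then show "card {v \<in> V. 3 \<le> w v} \<le> k \<Longrightarrow> \<exists>S. deletion_set V {} w S \<and> card S \<le> k" by blast
qed

lemma linear_forest_deletion_yes_iff:
  assumes "forest F"
  shows "linear_forest_deletion_yes (F, k) \<longleftrightarrow>
    (\<exists>S. deletion_set (verts F) (edges F) (\<lambda>_. 0) S \<and> card S \<le> k)"
proof -
  have "deletion_set (verts F) (edges F) (\<lambda>_. 0) S \<longleftrightarrow> claw_deletion_set F S" for S
    using claw_deletion_set_induced_iff[OF assms order_refl] induced_verts[of F] assms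
    by (simp add: forest_def)
  moreover have "linear_forest (delete_verts F S) \<longleftrightarrow> claw_free (delete_verts F S)" for S
    unfolding delete_verts_def by (intro linear_forest_iff_claw_free forest_induced assms)
  ultimately show ?thesis by (auto simp: linear_forest_deletion_yes_def claw_deletion_set_def)
qed

section \<open>The random access machine\<close>

text \<open>Straight-line blocks and loop bodies always terminate, so their effect is a function
  \<open>run\<close> that the simplifier can evaluate, and their cost is bounded by a constant of
  the program text.\<close>

fun loop_free :: "ram_prog \<Rightarrow> bool" where
  "loop_free (Seq P Q) \<longleftrightarrow> loop_free P \<and> loop_free Q"
| "loop_free (IfNz i P Q) \<longleftrightarrow> loop_free P \<and> loop_free Q"
| "loop_free (WhileNz i P) \<longleftrightarrow> False"
| "loop_free _ \<longleftrightarrow> True"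

fun run :: "ram_prog \<Rightarrow> ram_state \<Rightarrow> ram_state" where
  "run (Const i c) (R, M) = (R(i := c), M)"
| "run (Add i j k) (R, M) = (R(i := R j + R k), M)"
| "run (Sub i j k) (R, M) = (R(i := R j - R k), M)"
| "run (Load i j) (R, M) = (R(i := M (R j)), M)"
| "run (Store i j) (R, M) = (R, M(R i := R j))"
| "run (Seq P Q) s = run Q (run P s)"
| "run (IfNz i P Q) s = (if fst s i \<noteq> 0 then run P s else run Q s)"
| "run _ s = s"

fun cost :: "ram_prog \<Rightarrow> nat" where
  "cost (Seq P Q) = cost P + cost Q"
| "cost (IfNz i P Q) = 1 + max (cost P) (cost Q)"
| "cost _ = 1"

lemma ram_exec_loop_free: "loop_free P \<Longrightarrow> \<exists>t. ram_exec P s t (run P s) \<and> t \<le> cost P"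
proof (induction P arbitrary: s)
  case (Seq P Q)
  obtain t where t: "ram_exec P s t (run P s)" "t \<le> cost P" using Seq by (meson loop_free.simps)
  obtain t' where t': "ram_exec Q (run P s) t' (run Q (run P s))" "t' \<le> cost Q"
    using Seq by (meson loop_free.simps)
  show ?case using ram_exec.intros(7)[OF t(1) t'(1)] t(2) t'(2) by (auto intro!: exI[of _ "t + t'"])
next
  case (IfNz i P Q)
  show ?case
  proof (cases "fst s i = 0")
    case True
    obtain t where t: "ram_exec Q s t (run Q s)" "t \<le> cost Q" using IfNz by (meson loop_free.simps)
    show ?thesis using ram_exec.intros(9)[OF True t(1)] t(2) True by (auto intro!: exI[of _ "1 + t"])
  next
    case False
    obtain t where t: "ram_exec P s t (run P s)" "t \<le> cost P" using IfNz by (meson loop_free.simps)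
    show ?thesis using ram_exec.intros(8)[OF False t(1)] t(2) False by (auto intro!: exI[of _ "1 + t"])
  qed
next
  case Skip
  show ?case using ram_exec.intros(1)[of s] by (intro exI[of _ 1]) (cases s, simp)
next
  case (Const i c)
  show ?case using ram_exec.intros(2)[of i c "fst s" "snd s"] by (intro exI[of _ 1]) (cases s, simp)
next
  case (Add i j k)
  show ?case using ram_exec.intros(3)[of i j k "fst s" "snd s"] by (intro exI[of _ 1]) (cases s, simp)
next
  case (Sub i j k)
  show ?case using ram_exec.intros(4)[of i j k "fst s" "snd s"] by (intro exI[of _ 1]) (cases s, simp)
next
  case (Load i j)
  show ?case using ram_exec.intros(5)[of i j "fst s" "snd s"] by (intro exI[of _ 1]) (cases s, simp)
next
  case (Store i j)
  show ?case using ram_exec.intros(6)[of i j "fst s" "snd s"] by (intro exI[of _ 1]) (cases s, simp)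
qed simp

text \<open>A total-correctness triple with time bound \<open>b\<close>, for the single initial
  state \<open>s\<close>.\<close>

definition ends_within :: "nat \<Rightarrow> ram_prog \<Rightarrow> ram_state \<Rightarrow> (ram_state \<Rightarrow> bool) \<Rightarrow> bool" where
  "ends_within b P s Q \<longleftrightarrow> (\<exists>t s'. ram_exec P s t s' \<and> t \<le> b \<and> Q s')"

lemma ends_within_loop_free: "loop_free P \<Longrightarrow> Q (run P s) \<Longrightarrow> ends_within (cost P) P s Q"
  using ram_exec_loop_free unfolding ends_within_def by blast

lemma ends_within_Seq:
  assumes "ends_within b P s Q" "\<And>s'. Q s' \<Longrightarrow> ends_within b' P' s' Q'"
  shows "ends_within (b + b') (Seq P P') s Q'"
proof -
  obtain t s' where t: "ram_exec P s t s'" "t \<le> b" "Q s'"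
    using assms(1) by (auto simp: ends_within_def)
  obtain t' s'' where t': "ram_exec P' s' t' s''" "t' \<le> b'" "Q' s''"
    using assms(2)[OF t(3)] by (auto simp: ends_within_def)
  show ?thesis unfolding ends_within_def
    using ram_exec.intros(7)[OF t(1) t'(1)] t t' by (intro exI[of _ "t + t'"] exI[of _ s'']) simp
qed

text \<open>The index \<open>m\<close> of the invariant is also a variant and so bounds the number
  of iterations. Each costs its body and one test; the final 1 is the failing test.\<close>

lemma ends_within_While:
  assumes "loop_free P" "I m s"
    and "\<And>m s. I m s \<Longrightarrow> fst s i \<noteq> 0 \<Longrightarrow> \<exists>m'<m. I m' (run P s)"
  shows "ends_within (Suc (cost P) * m + 1) (WhileNz i P) s (\<lambda>s'. fst s' i = 0 \<and> (\<exists>m'. I m' s'))"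
  using assms(2)
proof (induction m arbitrary: s rule: less_induct)
  case (less m)
  show ?case
  proof (cases "fst s i = 0")
    case True
    then show ?thesis unfolding ends_within_def
      using less.prems ram_exec.intros(10)[OF True, of P] by (intro exI[of _ 1] exI[of _ s]) auto
  next
    case False
    obtain m' where m': "m' < m" "I m' (run P s)" using assms(3)[OF less.prems False] by auto
    obtain t where t: "ram_exec P s t (run P s)" "t \<le> cost P"
      using ram_exec_loop_free[OF assms(1)] by blast
    obtain t' s' where t': "ram_exec (WhileNz i P) (run P s) t' s'" "t' \<le> Suc (cost P) * m' + 1"
      "fst s' i = 0" "\<exists>m'. I m' s'" using less.IH[OF m'] unfolding ends_within_def by blast
    have "Suc (cost P) * Suc m' \<le> Suc (cost P) * m" using m'(1) by (intro mult_le_mono2) simp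
    then have "1 + t + t' \<le> Suc (cost P) * m + 1" using t(2) t'(2) by simp
    then show ?thesis unfolding ends_within_def
      using ram_exec.intros(11)[OF False t(1) t'(1)] t'(3,4)
      by (intro exI[of _ "1 + t + t'"] exI[of _ s']) auto
  qed
qed

lemma ends_within_mono:
  "ends_within b P s Q \<Longrightarrow> b \<le> b' \<Longrightarrow> (\<And>s'. Q s' \<Longrightarrow> Q' s') \<Longrightarrow> ends_within b' P s Q'"
  unfolding ends_within_def using le_trans by blast

section \<open>The program\<close>

fun block :: "ram_prog list \<Rightarrow> ram_prog" where
  "block [] = Skip"
| "block (P # Ps) = Seq P (block Ps)"

text \<open>Registers 0, 1, 2, 13 hold the constants 0, 1, 2, 3, and registers 3, 4 hold the number of
  vertices and the bound on the deletion set. Vertex \<open>v\<close> owns the three memory cells from address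
  \<open>B + 3 + 3 v\<close> on, where \<open>B\<close> is the length of the input: residual degree, sum of the residual
  neighbours, weight. The neighbour of a leaf is thus read off from its second cell.\<close>

definition prog_init :: ram_prog where
  "prog_init = block [Const 1 1, Load 3 0, Load 4 1, Const 2 2, Const 13 3, Const 5 2, Add 6 3 0]"

text \<open>The machine is not told the length of its input, but the work area starts right behind
  it. This loop finds the end by jumping from one degree entry to the next.\<close>

definition body_length :: ram_prog where
  "body_length = block [Load 8 5, Add 5 5 8, Add 5 5 1, Sub 6 6 1]"

definition prog_read_init :: ram_prog where
  "prog_read_init = block [Add 7 5 0, Add 10 5 0, Sub 6 5 2, Const 5 2]"

text \<open>One input token per iteration, which replaces a nested loop: register 9 counts the
  neighbours still expected for the current vertex, so the token is a neighbour if it is nonzero and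
  the degree of the next vertex otherwise. Register 7 is the address of the current triple.\<close>

definition body_read :: ram_prog where
  "body_read = block [Load 8 5,
     IfNz 9 (block [Add 11 7 1, Load 12 11, Add 12 12 8, Store 11 12, Sub 9 9 1])
       (block [Add 7 7 13, Store 7 8, Add 9 8 0]),
     Add 5 5 1, Sub 6 6 1]"

definition prog_peel_init :: ram_prog where
  "prog_peel_init = block [Add 7 10 13, Const 5 0, Const 8 0, Add 6 3 0]"

text \<open>Clears degree and neighbour sum of the leaf, takes it out of degree and sum of its
  neighbour, and adds \<open>leaf_weight\<close> to the weight there. Register 8 then moves to that
  neighbour, the only vertex that can have become a leaf.\<close>

definition prog_peel :: ram_prog where
  "prog_peel = block [Store 9 0, Add 9 9 1, Load 11 9, Store 9 0, Add 9 9 1, Load 12 9,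
     Add 9 7 11, Add 9 9 11, Add 9 9 11, Load 10 9, Sub 10 10 1, Store 9 10,
     Add 9 9 1, Load 10 9, Sub 10 10 8, Store 9 10,
     Add 9 9 1, Load 10 9, Sub 14 12 2,
     IfNz 14 Skip (block [Sub 14 12 1, IfNz 14 (Add 10 10 13) (Add 10 10 1)]),
     Store 9 10, Add 8 11 0]"

text \<open>With \<open>d\<close> the residual degree, \<open>d - (d - 1) - (d - 1)\<close> is nonzero only for \<open>d = 1\<close>.\<close>

definition body_peel :: ram_prog where
  "body_peel = block [Add 9 7 8, Add 9 9 8, Add 9 9 8, Load 10 9, Sub 11 10 1, Sub 10 10 11, Sub 10 10 11,
     IfNz 10 prog_peel (block [Add 5 5 1, Add 8 5 0, Sub 6 3 5])]"

definition prog_count_init :: ram_prog where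
  "prog_count_init = block [Add 6 3 0, Const 5 0, Add 7 7 2]"

text \<open>Truncated subtraction of 2 leaves a nonzero value exactly for weights of at least
  3.\<close>

definition body_count :: ram_prog where
  "body_count = block [Load 8 7, Sub 8 8 2, IfNz 8 (Add 5 5 1) Skip, Add 7 7 13, Sub 6 6 1]"

definition prog_answer :: ram_prog where
  "prog_answer = block [Sub 8 5 4, IfNz 8 (Const 0 0) (Const 0 1)]"

lemmas prog_defs = prog_init_def body_length_def prog_read_init_def body_read_def prog_peel_init_def
  prog_peel_def body_peel_def prog_count_init_def body_count_def prog_answer_def

definition prog :: ram_prog where
  "prog = Seq prog_init (Seq (WhileNz 6 body_length) (Seq prog_read_init (Seq (WhileNz 6 body_read)
     (Seq prog_peel_init (Seq (WhileNz 6 body_peel)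
     (Seq prog_count_init (Seq (WhileNz 6 body_count) prog_answer)))))))"

section \<open>Memory cells and symbolic execution of the peeling step\<close>

lemma triple_address_neq:
  fixes b u v :: nat
  shows "Suc (b + 3 * u) \<noteq> b + 3 * v" "b + 3 * u \<noteq> Suc (b + 3 * v)"
    "Suc (Suc (b + 3 * u)) \<noteq> b + 3 * v" "b + 3 * u \<noteq> Suc (Suc (b + 3 * v))"
  by presburger+

text \<open>Written as repeated addition, the way the program computes the address, so that folding
  the definition turns machine addresses into cells.\<close>

definition cell :: "nat \<Rightarrow> nat \<Rightarrow> nat" where "cell b v = b + v + v + v"

lemma cell_neq:
  "cell b u = cell b v \<longleftrightarrow> u = v"
  "Suc (cell b u) \<noteq> cell b v" "cell b u \<noteq> Suc (cell b v)"
  "Suc (Suc (cell b u)) \<noteq> cell b v" "cell b u \<noteq> Suc (Suc (cell b v))"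
  unfolding cell_def by presburger+

lemma run_body_peel_skip:
  assumes "R 1 = 1" "M (cell (R 7) (R 8)) \<noteq> 1"
  shows "snd (run body_peel (R, M)) = M"
    "\<forall>i\<in>{0, 1, 2, 3, 4, 7, 13}. fst (run body_peel (R, M)) i = R i"
    "fst (run body_peel (R, M)) 5 = Suc (R 5)" "fst (run body_peel (R, M)) 8 = Suc (R 5) + R 0"
    "fst (run body_peel (R, M)) 6 = R 3 - Suc (R 5)"
proof -
  define d where "d = M (cell (R 7) (R 8))"
  have "d - (d - Suc 0) - (d - Suc 0) = 0" using assms(2) by (auto simp: d_def)
  then have *: "d \<le> d - Suc 0 + (d - Suc 0)" by simp
  show "snd (run body_peel (R, M)) = M"
    "\<forall>i\<in>{0, 1, 2, 3, 4, 7, 13}. fst (run body_peel (R, M)) i = R i"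
    "fst (run body_peel (R, M)) 5 = Suc (R 5)" "fst (run body_peel (R, M)) 8 = Suc (R 5) + R 0"
    "fst (run body_peel (R, M)) 6 = R 3 - Suc (R 5)"
    using assms(1) * by (simp_all add: body_peel_def cell_def[symmetric] d_def[symmetric])
qed

text \<open>\<open>p \<noteq> v\<close> keeps the two triples apart, so the reads at
  \<open>p\<close> see the memory as it was before the triple of \<open>v\<close> was
  changed.\<close>

lemma run_body_peel_leaf:
  assumes "R 0 = 0" "R 1 = 1" "R 2 = 2" "R 13 = 3" "R 7 = b" "R 8 = v" "p \<noteq> v"
    "M (cell b v) = 1" "M (Suc (cell b v)) = p" "M (Suc (Suc (cell b v))) = c"
  shows "snd (run body_peel (R, M)) = M(cell b v := 0, Suc (cell b v) := 0, cell b p := M (cell b p) - 1,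
       Suc (cell b p) := M (Suc (cell b p)) - v,
       Suc (Suc (cell b p)) := M (Suc (Suc (cell b p))) + leaf_weight c)"
    "\<forall>i\<in>{0, 1, 2, 3, 4, 5, 6, 7, 13}. fst (run body_peel (R, M)) i = R i"
    "fst (run body_peel (R, M)) 8 = p"
proof -
  consider "3 \<le> c" | "c = 2" | "c < 2" by linarith
  then have "snd (run body_peel (R, M)) = M(cell b v := 0, Suc (cell b v) := 0, cell b p := M (cell b p) - 1,
       Suc (cell b p) := M (Suc (cell b p)) - v,
       Suc (Suc (cell b p)) := M (Suc (Suc (cell b p))) + leaf_weight c) \<and>
    (\<forall>i\<in>{0, 1, 2, 3, 4, 5, 6, 7, 13}. fst (run body_peel (R, M)) i = R i) \<and>
    fst (run body_peel (R, M)) 8 = p"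
    using assms
    by cases (simp_all add: body_peel_def prog_peel_def cell_neq leaf_weight_def cell_def[symmetric])
  then show "snd (run body_peel (R, M)) = M(cell b v := 0, Suc (cell b v) := 0, cell b p := M (cell b p) - 1,
       Suc (cell b p) := M (Suc (cell b p)) - v,
       Suc (Suc (cell b p)) := M (Suc (Suc (cell b p))) + leaf_weight c)"
    "\<forall>i\<in>{0, 1, 2, 3, 4, 5, 6, 7, 13}. fst (run body_peel (R, M)) i = R i"
    "fst (run body_peel (R, M)) 8 = p"
    by blast+
qed

lemma concat_map_Cons_eq_Nil: "concat (map (\<lambda>ns. f ns # ns) xss) = [] \<longleftrightarrow> xss = []"
  by (cases xss) auto

lemma drop_eq_ConsD:
  assumes "drop i xs = y # ys"
  shows "i < length xs" "xs ! i = y" "drop (Suc i) xs = ys"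
  using assms
  by (metis drop_all linorder_not_less list.distinct(1), metis assms nth_via_drop,
      metis assms drop_Suc tl_drop list.sel(3))

lemma drop_eq_appendD: "drop i xs = ys @ zs \<Longrightarrow> drop (i + length ys) xs = zs"
  by (metis add.commute append_eq_conv_conj drop_drop)

section \<open>Reading the input\<close>

locale encoded_forest =
  fixes F :: "nat graph" and k :: nat and adj :: "nat list list" and xs :: "nat list"
  assumes forest: "forest F" and verts: "verts F = {..<length adj}"
    and distinct_adj: "\<And>i. i < length adj \<Longrightarrow> distinct (adj ! i)"
    and set_adj: "\<And>i. i < length adj \<Longrightarrow> set (adj ! i) = nbrs (edges F) i"
    and xs: "xs = length adj # k # concat (map (\<lambda>ns. length ns # ns) adj)"
begin

abbreviation n :: nat where "n \<equiv> length adj"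
abbreviation B :: nat where "B \<equiv> length xs"
abbreviation tokens :: "nat list list \<Rightarrow> nat list" where
  "tokens \<equiv> \<lambda>nss. concat (map (\<lambda>ns. length ns # ns) nss)"

lemma simple: "simple_graph F" using forest by (simp add: forest_def)

definition const_regs :: "(nat \<Rightarrow> nat) \<Rightarrow> bool" where
  "const_regs R \<longleftrightarrow> R 0 = 0 \<and> R 1 = 1 \<and> R 2 = 2 \<and> R 13 = 3 \<and> R 3 = n \<and> R 4 = k"

definition input_mem :: "nat \<Rightarrow> nat" where "input_mem i = (if i < B then xs ! i else 0)"

text \<open>\<open>m\<close> vertices are still to be passed. \<open>R 9 = 0\<close> is carried
  along because the reading loop starts with no neighbour expected.\<close>

definition inv_length :: "nat \<Rightarrow> ram_state \<Rightarrow> bool" where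
  "inv_length m = (\<lambda>(R, M). const_regs R \<and> M = input_mem \<and> R 9 = 0 \<and> R 6 = m \<and> m \<le> n \<and> R 5 \<le> B \<and>
     drop (R 5) xs = tokens (drop (n - m) adj))"

lemma inv_length_init: "inv_length n (run prog_init (ram_init xs))"
proof -
  have "xs ! 0 = n" "xs ! 1 = k" "2 \<le> B" by (simp_all add: xs)
  then have "input_mem 0 = n" "input_mem 1 = k" by (auto simp: input_mem_def)
  moreover have "ram_init xs = (\<lambda>_. 0, input_mem)" by (simp add: ram_init_def input_mem_def fun_eq_iff)
  moreover have "2 \<le> B" "drop 2 xs = tokens adj" by (simp_all add: xs)
  ultimately show ?thesis by (simp add: inv_length_def const_regs_def prog_defs)
qed

lemma inv_length_step:
  assumes "inv_length m s" "fst s 6 \<noteq> 0"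
  shows "\<exists>m'<m. inv_length m' (run body_length s)"
proof -
  obtain R M where s: "s = (R, M)" by (cases s)
  have I: "const_regs R" "M = input_mem" "R 9 = 0" "R 6 = m" "m \<le> n" "R 5 \<le> B"
    "drop (R 5) xs = tokens (drop (n - m) adj)" "m \<noteq> 0"
    using assms by (auto simp: inv_length_def s)
  let ?ns = "adj ! (n - m)"
  have "drop (n - m) adj = ?ns # drop (n - (m - 1)) adj"
    using I(5,8) Cons_nth_drop_Suc[of "n - m" adj] by (simp add: Suc_diff_le)
  then have d: "drop (R 5) xs = length ?ns # ?ns @ tokens (drop (n - (m - 1)) adj)" using I by simp
  note d' = drop_eq_ConsD[OF d]
  have "input_mem (R 5) = length ?ns" using d' by (simp add: input_mem_def)
  moreover have "drop (Suc (R 5 + length ?ns)) xs = tokens (drop (n - (m - 1)) adj)"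
    using drop_eq_appendD[OF d'(3)] by simp
  moreover have "Suc (R 5 + length ?ns) \<le> B"
    using arg_cong[OF d, of length] d'(1) by simp
  ultimately have "inv_length (m - 1) (run body_length s)"
    using I by (simp add: s inv_length_def const_regs_def prog_defs)
  then show ?thesis using I(8) by (intro exI[of _ "m - 1"]) simp
qed

text \<open>The list is padded by an entry for the cells below those of vertex 0, which the reading loop
  treats as the vertex processed initially.\<close>

abbreviation adj' :: "nat list list" where "adj' \<equiv> [] # adj"

text \<open>\<open>j\<close> is the current entry of the padded list, \<open>zs\<close> are its
  neighbours already read and added up, and \<open>ys\<close> those still expected. The measure
  \<open>m = B - R 5\<close> counts the unread tokens.\<close>

definition reading :: "nat \<Rightarrow> (nat \<Rightarrow> nat) \<Rightarrow> (nat \<Rightarrow> nat) \<Rightarrow> nat \<Rightarrow> nat list \<Rightarrow> nat list \<Rightarrow> bool" where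
  "reading m R M j ys zs \<longleftrightarrow> const_regs R \<and> R 10 = B \<and> R 6 = m \<and> R 5 \<le> B \<and> m = B - R 5 \<and>
     (\<forall>a<B. M a = xs ! a) \<and>
     j \<le> n \<and> adj' ! j = zs @ ys \<and> R 9 = length ys \<and> R 7 = B + 3 * j \<and>
     drop (R 5) xs = ys @ tokens (drop (Suc j) adj') \<and>
     (\<forall>u\<le>n. M (B + 3 * u) = (if u \<le> j then length (adj' ! u) else 0) \<and>
        M (Suc (B + 3 * u)) =
          (if u < j then sum_list (adj' ! u) else if u = j then sum_list zs else 0) \<and>
        M (Suc (Suc (B + 3 * u))) = 0)"

definition inv_read :: "nat \<Rightarrow> ram_state \<Rightarrow> bool" where
  "inv_read m = (\<lambda>(R, M). \<exists>j ys zs. reading m R M j ys zs)"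

text \<open>Reading starts behind the two header tokens, with the padding entry, which has no
  neighbours, as the current one.\<close>

lemma inv_read_init:
  assumes "inv_length m s" "fst s 6 = 0"
  shows "inv_read (B - 2) (run prog_read_init s)"
proof -
  obtain R M where s: "s = (R, M)" by (cases s)
  have I: "const_regs R" "M = input_mem" "R 9 = 0" "R 5 \<le> B" "drop (R 5) xs = []"
    using assms by (auto simp: inv_length_def s)
  then have "R 5 = B" by simp
  moreover have "2 \<le> B" "drop 2 xs = tokens adj" by (simp_all add: xs)
  ultimately have "reading (B - 2) (fst (run prog_read_init s)) (snd (run prog_read_init s)) 0 [] []"
    using I unfolding reading_def s by (simp add: const_regs_def prog_defs input_mem_def)
  then show ?thesis by (auto simp: inv_read_def split_beta)
qed

lemma inv_read_step:
  assumes "inv_read m s" "fst s 6 \<noteq> 0"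
  shows "\<exists>m'<m. inv_read m' (run body_read s)"
proof -
  obtain R M where s: "s = (R, M)" by (cases s)
  obtain j ys zs where "reading m R M j ys zs" using assms(1) by (auto simp: inv_read_def s)
  then have I: "const_regs R" "R 10 = B" "R 6 = m" "R 5 \<le> B" "m = B - R 5" "\<And>a. a < B \<Longrightarrow> M a = xs ! a"
    and J: "j \<le> n" "adj' ! j = zs @ ys" "R 9 = length ys" "R 7 = B + 3 * j"
      "drop (R 5) xs = ys @ tokens (drop (Suc j) adj')"
    and mem: "\<And>u. u \<le> n \<Longrightarrow> M (B + 3 * u) = (if u \<le> j then length (adj' ! u) else 0)"
      "\<And>u. u \<le> n \<Longrightarrow> M (Suc (B + 3 * u)) =
         (if u < j then sum_list (adj' ! u) else if u = j then sum_list zs else 0)"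
      "\<And>u. u \<le> n \<Longrightarrow> M (Suc (Suc (B + 3 * u))) = 0"
    unfolding reading_def by blast+
  have m: "m \<noteq> 0" using assms(2) I(3) by (simp add: s)
  have lt: "R 5 < B" "Suc (R 5) \<le> B" using I(4,5) m by auto
  obtain R' M' where r: "run body_read s = (R', M')" by (cases "run body_read s")
  have "inv_read (m - 1) (R', M')"
  proof (cases ys)
    case (Cons y ys')
    note d = drop_eq_ConsD[OF J(5)[unfolded Cons append_Cons]]
    have M: "M (R 5) = y" using I(6) d by simp
    have rr: "const_regs R'" "R' 10 = B" "R' 6 = m - 1" "R' 5 = Suc (R 5)" "R' 9 = length ys'"
      "R' 7 = B + 3 * j" and M': "M' = M(Suc (B + 3 * j) := sum_list zs + y)"
      using r I J(3,4) Cons M mem(2)[OF J(1)] unfolding s by (auto simp: prog_defs const_regs_def)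
    have "reading (m - 1) R' M' j ys' (zs @ [y])" unfolding reading_def
    proof (intro conjI allI impI)
      show "M' a = xs ! a" if "a < B" for a using that I(6) M' by simp
      fix u assume u: "u \<le> n"
      show "M' (B + 3 * u) = (if u \<le> j then length (adj' ! u) else 0)"
        using mem(1)[OF u] unfolding M' fun_upd_apply triple_address_neq by auto
      show "M' (Suc (B + 3 * u)) = (if u < j then sum_list (adj' ! u)
          else if u = j then sum_list (zs @ [y]) else 0)"
        using mem(2)[OF u] unfolding M' by auto
      show "M' (Suc (Suc (B + 3 * u))) = 0" using mem(3)[OF u] unfolding M' by (simp add: triple_address_neq)
    qed (use rr lt I(5) J Cons d in auto)
    then show ?thesis by (auto simp: inv_read_def)
  next
    case Nil
    \<comment> \<open>Tokens remain but none belongs to the current entry, so another vertex follows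
      and the token is its degree.\<close>
    have "drop (Suc j) adj' \<noteq> []" using J(5) Nil lt by auto
    then have jn: "j < n" by simp
    then have dj: "drop (Suc j) adj' = adj' ! Suc j # drop (Suc (Suc j)) adj'"
      by (simp add: Cons_nth_drop_Suc)
    have "drop (R 5) xs = length (adj' ! Suc j) # adj' ! Suc j @ tokens (drop (Suc (Suc j)) adj')"
      using J(5) unfolding dj Nil by simp
    note d = drop_eq_ConsD[OF this]
    have M: "M (R 5) = length (adj' ! Suc j)" using I(6) d by simp
    have rr: "const_regs R'" "R' 10 = B" "R' 6 = m - 1" "R' 5 = Suc (R 5)" "R' 9 = length (adj' ! Suc j)"
      "R' 7 = B + 3 * Suc j" and M': "M' = M(B + 3 * Suc j := length (adj' ! Suc j))"
      using r I J(3,4) Nil M unfolding s by (auto simp: prog_defs const_regs_def)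
    have "reading (m - 1) R' M' (Suc j) (adj' ! Suc j) []" unfolding reading_def
    proof (intro conjI allI impI)
      show "M' a = xs ! a" if "a < B" for a using that I(6) M' by simp
      fix u assume u: "u \<le> n"
      show "M' (B + 3 * u) = (if u \<le> Suc j then length (adj' ! u) else 0)"
        using mem(1)[OF u] unfolding M' by (cases "u = Suc j") auto
      show "M' (Suc (B + 3 * u)) = (if u < Suc j then sum_list (adj' ! u)
          else if u = Suc j then sum_list [] else 0)"
        using mem(2)[OF u] J(2) Nil unfolding M' fun_upd_apply triple_address_neq
        by (auto simp: less_Suc_eq)
      show "M' (Suc (Suc (B + 3 * u))) = 0"
        using mem(3)[OF u] unfolding M' by (simp only: fun_upd_other[OF triple_address_neq(3)])
    qed (use rr lt I(5) jn d in auto)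
    then show ?thesis by (auto simp: inv_read_def)
  qed
  then show ?thesis using r m by (intro exI[of _ "m - 1"]) simp
qed

section \<open>The peeling loop\<close>

text \<open>Skips the padding triple, so that vertex \<open>u\<close> is entry \<open>Suc u\<close>
  of the padded list.\<close>

definition base :: nat where "base = B + 3"

definition represents :: "(nat \<Rightarrow> nat) \<Rightarrow> nat set set \<Rightarrow> (nat \<Rightarrow> nat) \<Rightarrow> bool" where
  "represents M E w \<longleftrightarrow> (\<forall>u<n. M (cell base u) = card (nbrs E u) \<and>
     M (Suc (cell base u)) = \<Sum> (nbrs E u) \<and> M (Suc (Suc (cell base u))) = w u)"

text \<open>\<open>R 5\<close> is the position of a scan through the vertices and \<open>R 8\<close>
  the vertex under inspection, which moves to the neighbour after each peeling. No vertex up to the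
  scan position other than \<open>R 8\<close> is a leaf. The measure drops because each iteration
  either removes an edge or advances the scan.\<close>

definition inv_peel :: "nat \<Rightarrow> ram_state \<Rightarrow> bool" where
  "inv_peel m = (\<lambda>(R, M). const_regs R \<and> R 7 = base \<and> R 6 = n - R 5 \<and> R 5 \<le> n \<and> (R 8 < n \<longleftrightarrow> R 5 < n) \<and>
     (\<exists>E w. E \<subseteq> edges F \<and> represents M E w \<and> m = card E + (n - R 5) \<and>
        (\<forall>u<n. u \<le> R 5 \<longrightarrow> card (nbrs E u) = 1 \<longrightarrow> u = R 8) \<and>
        (\<forall>l. (\<exists>S. deletion_set (verts F) E w S \<and> card S \<le> l) \<longleftrightarrow>
          (\<exists>S. deletion_set (verts F) (edges F) (\<lambda>_. 0) S \<and> card S \<le> l))))"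

lemma inv_peel_init:
  assumes "inv_read m s" "fst s 6 = 0"
  shows "inv_peel (card (edges F) + n) (run prog_peel_init s)"
proof -
  obtain R M where s: "s = (R, M)" by (cases s)
  obtain j ys zs where "reading m R M j ys zs" using assms(1) by (auto simp: inv_read_def s)
  then have I: "const_regs R" "R 10 = B" "R 6 = m" "R 5 \<le> B" "m = B - R 5" "\<And>a. a < B \<Longrightarrow> M a = xs ! a"
    and J: "j \<le> n" "adj' ! j = zs @ ys" "R 9 = length ys" "R 7 = B + 3 * j"
      "drop (R 5) xs = ys @ tokens (drop (Suc j) adj')"
    and mem: "\<And>u. u \<le> n \<Longrightarrow> M (B + 3 * u) = (if u \<le> j then length (adj' ! u) else 0)"
      "\<And>u. u \<le> n \<Longrightarrow> M (Suc (B + 3 * u)) =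
         (if u < j then sum_list (adj' ! u) else if u = j then sum_list zs else 0)"
      "\<And>u. u \<le> n \<Longrightarrow> M (Suc (Suc (B + 3 * u))) = 0"
    unfolding reading_def by blast+
  then have z: "drop (R 5) xs = []" using assms(2) by (simp add: s)
  \<comment> \<open>No token is left, so the current entry is complete and is the last one.\<close>
  have "ys = []" "drop (Suc j) adj' = []" using J(5) z concat_map_Cons_eq_Nil by fastforce+
  then have j: "j = n" "zs = adj' ! n" using J by auto
  have mem': "M (B + 3 * u) = length (adj' ! u)" "M (Suc (B + 3 * u)) = sum_list (adj' ! u)" if "u \<le> n" for u
    using mem(1,2)[OF that] that j by (cases "u = n", auto)+
  have "represents M (edges F) (\<lambda>_. 0)" unfolding represents_def
  proof (intro allI impI)
    fix u assume u: "u < n"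
    have cu: "cell base u = B + 3 * Suc u" by (simp add: cell_def base_def)
    have "length (adj ! u) = card (nbrs (edges F) u)" "sum_list (adj ! u) = \<Sum> (nbrs (edges F) u)"
      using distinct_card[OF distinct_adj[OF u]] sum_list_distinct_conv_sum_set[OF distinct_adj[OF u], of id] set_adj[OF u]
      by auto
    then show "M (cell base u) = card (nbrs (edges F) u) \<and>
      M (Suc (cell base u)) = \<Sum> (nbrs (edges F) u) \<and> M (Suc (Suc (cell base u))) = 0"
      using mem'[of "Suc u"] mem(3)[of "Suc u"] u cu by simp
  qed
  then show ?thesis using I unfolding s inv_peel_def
    by (auto simp: prog_defs const_regs_def base_def intro!: exI[of _ "edges F"] exI[of _ "\<lambda>_. 0"])
qed

lemma inv_peel_step:
  assumes "inv_peel m s" "fst s 6 \<noteq> 0"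
  shows "\<exists>m'<m. inv_peel m' (run body_peel s)"
proof -
  obtain R M where s: "s = (R, M)" by (cases s)
  define v where "v = R 8"
  have I: "const_regs R" "R 7 = base" "R 6 = n - R 5" "R 5 < n" "v < n"
    using assms by (auto simp: inv_peel_def s v_def)
  obtain E w where E: "E \<subseteq> edges F" "represents M E w" "m = card E + (n - R 5)"
    "\<And>u. u < n \<Longrightarrow> u \<le> R 5 \<Longrightarrow> card (nbrs E u) = 1 \<Longrightarrow> u = v"
    "\<And>l. (\<exists>S. deletion_set (verts F) E w S \<and> card S \<le> l) \<longleftrightarrow>
          (\<exists>S. deletion_set (verts F) (edges F) (\<lambda>_. 0) S \<and> card S \<le> l)"
    using assms(1) unfolding inv_peel_def s v_def prod.case by blast
  have Mv: "M (cell base u) = card (nbrs E u)" "M (Suc (cell base u)) = \<Sum> (nbrs E u)"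
    "M (Suc (Suc (cell base u))) = w u" if "u < n" for u
    using E(2) that by (auto simp: represents_def)
  obtain R' M' where r: "run body_peel s = (R', M')" by (cases "run body_peel s")
  show ?thesis
  proof (cases "card (nbrs E v) = 1")
    case False
    have rr: "const_regs R'" "R' 7 = base" "R' 5 = Suc (R 5)" "R' 8 = Suc (R 5)"
        "R' 6 = n - Suc (R 5)" "M' = M"
      using run_body_peel_skip[of R M] False Mv(1)[of v] I r
      by (simp_all add: s const_regs_def v_def)
    have "inv_peel (m - 1) (R', M')"
      unfolding inv_peel_def prod.case
    proof (intro conjI exI[of _ E] exI[of _ w] allI impI)
      \<comment> \<open>The only leaf allowed up to the old position was \<open>v\<close>, which is
        none; the position just reached is the only candidate, and it is the new vertex under
        inspection.\<close>
      fix u assume "u < n" "u \<le> R' 5" "card (nbrs E u) = 1"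
      then show "u = R' 8" using E(4)[of u] False rr by (auto simp: le_Suc_eq)
    qed (use rr I E in auto)
    then show ?thesis using r I(4) E(3) by (intro exI[of _ "m - 1"]) simp
  next
    case True
    then obtain p where p: "nbrs E v = {p}" by (auto simp: card_1_singleton_iff)
    then have vp: "{v, p} \<in> E" by (auto simp: nbrs_def)
    then have pF: "p \<in> nbrs (edges F) v" using E(1) by (auto simp: nbrs_def)
    have pv: "p < n" "p \<noteq> v" 
      using pF nbrs_subset_verts[OF simple, of v] self_notin_nbrs[OF simple, of v] verts by auto
    let ?E = "E - {{v, p}}" and ?w = "w(p := w p + leaf_weight (w v))"
    have nv: "nbrs ?E v = {}" using p by (auto simp: nbrs_def)
    have np: "nbrs ?E p = nbrs E p - {v}" by (auto simp: nbrs_def doubleton_eq_iff)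
    have nx: "nbrs ?E x = nbrs E x" if "x \<noteq> v" "x \<noteq> p" for x
      using that by (auto simp: nbrs_def doubleton_eq_iff)
    have vE: "v \<in> nbrs E p" using vp by (simp add: nbrs_def insert_commute)
    have "nbrs E p \<subseteq> nbrs (edges F) p" using E(1) by (auto simp: nbrs_def)
    then have finp: "finite (nbrs E p)" using finite_nbrs[OF simple] finite_subset by blast
    let ?a = "cell base v" and ?b = "cell base p"
    have rr: "const_regs R'" "R' 7 = base" "R' 5 = R 5" "R' 8 = p" "R' 6 = n - R 5"
      "M' = M(?a := 0, Suc ?a := 0, ?b := card (nbrs E p) - 1, Suc ?b := \<Sum> (nbrs E p) - v,
         Suc (Suc ?b) := w p + leaf_weight (w v))"
      using run_body_peel_leaf[of R base v p M "w v"] True Mv[OF I(5)] Mv[OF pv(1)] I(1-3) p pv(2) r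
      by (simp_all add: s const_regs_def v_def)
    have "represents M' ?E ?w" unfolding represents_def
    proof (intro allI impI)
      fix u assume u: "u < n"
      consider "u = v" | "u = p" | "u \<noteq> v" "u \<noteq> p" by blast
      then show "M' (cell base u) = card (nbrs ?E u) \<and> M' (Suc (cell base u)) = \<Sum> (nbrs ?E u) \<and>
        M' (Suc (Suc (cell base u))) = ?w u"
      proof cases
        case 1
        then show ?thesis using Mv[OF u] pv nv unfolding rr by (simp add: cell_neq)
      next
        case 2
        \<comment> \<open>Since \<open>v\<close> is a neighbour of \<open>p\<close>, neither
          truncated subtraction loses anything.\<close>
        have "card (nbrs ?E p) = card (nbrs E p) - 1" "\<Sum> (nbrs ?E p) = \<Sum> (nbrs E p) - v"
          using vE finp sum.remove[OF finp vE, of id] by (simp_all add: np)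
        then show ?thesis using 2 unfolding rr by (simp add: cell_neq)
      next
        case 3
        then show ?thesis using Mv[OF u] nx[of u] unfolding rr by (simp add: cell_neq)
      qed
    qed
    moreover have "card E = Suc (card ?E)"
    proof -
      have "edges F \<subseteq> Pow (verts F)" using simple by (auto simp: simple_graph_def)
      then have "finite E" using E(1) verts finite_subset by (metis finite_Pow_iff finite_lessThan)
      then show ?thesis using card_Suc_Diff1[OF _ vp] by simp
    qed
    \<comment> \<open>Removing the edge isolates \<open>v\<close> and affects no degree other than
      that of \<open>p\<close>, so only \<open>p\<close> can have become a leaf.\<close>
    moreover have "u = p" if u: "u < n" "u \<le> R 5" "card (nbrs ?E u) = 1" for u
    proof (rule ccontr)
      assume "u \<noteq> p"
      moreover have "u \<noteq> v" using u nv by auto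
      ultimately show False using E(4)[of u] u nx by auto
    qed
    moreover have "(\<exists>S. deletion_set (verts F) ?E ?w S \<and> card S \<le> l) \<longleftrightarrow>
          (\<exists>S. deletion_set (verts F) (edges F) (\<lambda>_. 0) S \<and> card S \<le> l)" for l
      using deletion_set_peel_leaf[of "verts F" v p E w l] E(5)[of l] verts pv I(5) p by auto
    ultimately have "inv_peel (m - 1) (R', M')"
      unfolding inv_peel_def prod.case using rr I E(1,3) pv
      by (intro conjI exI[of _ ?E] exI[of _ ?w]) auto
    then show ?thesis using r I(4) E(3) by (intro exI[of _ "m - 1"]) simp
  qed
qed

section \<open>Counting and answering\<close>

definition inv_count :: "nat \<Rightarrow> ram_state \<Rightarrow> bool" where
  "inv_count m = (\<lambda>(R, M). const_regs R \<and> R 6 = m \<and> m \<le> n \<and> R 7 = Suc (Suc (cell base (n - m))) \<and>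
     (\<exists>w. (\<forall>u<n. M (Suc (Suc (cell base u))) = w u) \<and> R 5 = card {u. u < n - m \<and> 3 \<le> w u} \<and>
        (card {u. u < n \<and> 3 \<le> w u} \<le> k \<longleftrightarrow> linear_forest_deletion_yes (F, k))))"

lemma inv_count_init:
  assumes "inv_peel m s" "fst s 6 = 0"
  shows "inv_count n (run prog_count_init s)"
proof -
  obtain R M where s: "s = (R, M)" by (cases s)
  have I: "const_regs R" "R 7 = base" "R 5 = n" "\<not> R 8 < n"
    using assms by (auto simp: inv_peel_def s)
  obtain E w where E: "E \<subseteq> edges F" "represents M E w"
    "\<And>u. u < n \<Longrightarrow> card (nbrs E u) = 1 \<Longrightarrow> u = R 8"
    "\<And>l. (\<exists>S. deletion_set (verts F) E w S \<and> card S \<le> l) \<longleftrightarrow>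
          (\<exists>S. deletion_set (verts F) (edges F) (\<lambda>_. 0) S \<and> card S \<le> l)"
    using assms(1) I(3) unfolding inv_peel_def s by auto
  \<comment> \<open>A remaining edge would produce a leaf, which the invariant identifies with
    \<open>R 8\<close>; but \<open>R 8\<close> is no vertex once the scan has ended.\<close>
  have "E = {}"
  proof (rule ccontr)
    assume "E \<noteq> {}"
    let ?G = "\<lparr>verts = verts F, edges = E\<rparr>"
    have "forest ?G" using E(1) simple by (intro forest_subgraph[OF forest]) (auto simp: simple_graph_def)
    then obtain v where v: "v < n" "card (nbrs E v) = 1"
      using forest_edge_imp_leaf[of ?G] \<open>E \<noteq> {}\<close> verts by auto
    then show False using E(3) I(4) by blast
  qed
  then have "card {u. u < n \<and> 3 \<le> w u} \<le> k \<longleftrightarrow> linear_forest_deletion_yes (F, k)"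
    using E(4)[of k] deletion_set_edgeless_iff[of "verts F" w k] verts
      linear_forest_deletion_yes_iff[OF forest, of k] by simp
  moreover have "cell base 0 = base" by (simp add: cell_def)
  ultimately show ?thesis using I E(2) unfolding inv_count_def s
    by (auto simp: prog_defs const_regs_def represents_def intro!: exI[of _ w])
qed

lemma inv_count_step:
  assumes "inv_count m s" "fst s 6 \<noteq> 0"
  shows "\<exists>m'<m. inv_count m' (run body_count s)"
proof -
  obtain R M where s: "s = (R, M)" by (cases s)
  have I: "const_regs R" "R 6 = m" "m \<le> n" "R 7 = Suc (Suc (cell base (n - m)))" "m \<noteq> 0"
    using assms by (auto simp: inv_count_def s)
  obtain w where w: "\<And>u. u < n \<Longrightarrow> M (Suc (Suc (cell base u))) = w u"
    "R 5 = card {u. u < n - m \<and> 3 \<le> w u}"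
    "card {u. u < n \<and> 3 \<le> w u} \<le> k \<longleftrightarrow> linear_forest_deletion_yes (F, k)"
    using assms(1) unfolding inv_count_def s by auto
  define j where "j = n - m"
  have j: "j < n" "n - (m - 1) = Suc j" using I by (auto simp: j_def)
  have M: "M (Suc (Suc (cell base j))) = w j" using w(1) j by simp
  obtain R' M' where r: "run body_count s = (R', M')" by (cases "run body_count s")
  have rr: "const_regs R'" "R' 6 = m - 1" "R' 7 = Suc (Suc (cell base (Suc j)))"
      "R' 5 = (if 3 \<le> w j then Suc (R 5) else R 5)" "M' = M"
    using r I(1,2,4) M unfolding s j_def[symmetric] by (auto simp: prog_defs const_regs_def cell_def split: if_splits)
  have "{u. u < Suc j \<and> 3 \<le> w u} = (if 3 \<le> w j then insert j {u. u < j \<and> 3 \<le> w u} else {u. u < j \<and> 3 \<le> w u})"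
    by (auto simp: less_Suc_eq)
  then have "R' 5 = card {u. u < Suc j \<and> 3 \<le> w u}" using rr(4) w(2) by (simp add: j_def)
  then have "inv_count (m - 1) (R', M')" unfolding inv_count_def prod.case
    using rr w I j by auto
  then show ?thesis using r I(5) by (intro exI[of _ "m - 1"]) simp
qed

lemma inv_count_answer:
  assumes "inv_count m s" "fst s 6 = 0"
  shows "fst (run prog_answer s) 0 = (if linear_forest_deletion_yes (F, k) then 1 else 0)"
proof -
  obtain R M where s: "s = (R, M)" by (cases s)
  show ?thesis using assms by (auto simp: s inv_count_def prog_defs const_regs_def)
qed

section \<open>The time bound\<close>

text \<open>Bounds the iterations of the peeling loop by the input length: every vertex contributes
  its degree entry, and every edge is listed at least once.\<close>

lemma card_edges_le: "card (edges F) + n \<le> B"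
proof -
  have "edges F \<subseteq> (\<Union>v\<in>{..<n}. (\<lambda>u. {v, u}) ` nbrs (edges F) v)"
  proof
    fix e assume e: "e \<in> edges F"
    then obtain a b where "e = {a, b}" using simple by (metis card_2_iff simple_graph_def)
    then show "e \<in> (\<Union>v\<in>{..<n}. (\<lambda>u. {v, u}) ` nbrs (edges F) v)"
      using e simple verts by (intro UN_I[of a]) (auto simp: nbrs_def simple_graph_def)
  qed
  then have "card (edges F) \<le> card (\<Union>v\<in>{..<n}. (\<lambda>u. {v, u}) ` nbrs (edges F) v)"
    using finite_nbrs[OF simple] by (intro card_mono) auto
  also have "\<dots> \<le> (\<Sum>v<n. card ((\<lambda>u. {v, u}) ` nbrs (edges F) v))" by (rule card_UN_le) simp
  also have "\<dots> \<le> (\<Sum>v<n. length (adj ! v))"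
  proof (rule sum_mono)
    fix v assume "v \<in> {..<n}"
    then show "card ((\<lambda>u. {v, u}) ` nbrs (edges F) v) \<le> length (adj ! v)"
      using card_image_le[OF finite_nbrs[OF simple], of _ v] set_adj[of v] card_length[of "adj ! v"] le_trans
      by fastforce
  qed
  also have "\<dots> + n \<le> B"
  proof -
    have "B = 2 + sum_list (map (\<lambda>ns. Suc (length ns)) adj)"
      by (simp add: xs length_concat comp_def)
    also have "sum_list (map (\<lambda>ns. Suc (length ns)) adj) = (\<Sum>v<n. Suc (length (adj ! v)))"
      by (simp add: sum_list_sum_nth atLeast0LessThan)
    also have "\<dots> = (\<Sum>v<n. length (adj ! v)) + n" by (simp add: sum_Suc)
    finally show ?thesis by simp
  qed
  finally show ?thesis by simp
qed

lemma prog_correct: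
  "ends_within (1000 * (B + 1)) prog (ram_init xs)
     (\<lambda>s. fst s 0 = (if linear_forest_deletion_yes (F, k) then 1 else 0))"
proof -
  have lf: "loop_free body_length" "loop_free body_read" "loop_free body_peel" "loop_free body_count"
    "loop_free prog_init" "loop_free prog_read_init" "loop_free prog_peel_init"
    "loop_free prog_count_init" "loop_free prog_answer"
    by (simp_all add: prog_defs)
  have w1: "ends_within (Suc (cost body_length) * n + 1) (WhileNz 6 body_length) s
      (\<lambda>s. fst s 6 = 0 \<and> (\<exists>m. inv_length m s))" if "inv_length n s" for s
    using ends_within_While[OF lf(1) that inv_length_step] .
  have w2: "ends_within (Suc (cost body_read) * (B - 2) + 1) (WhileNz 6 body_read) s
      (\<lambda>s. fst s 6 = 0 \<and> (\<exists>m. inv_read m s))" if "inv_read (B - 2) s" for s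
    using ends_within_While[OF lf(2) that inv_read_step] .
  have w3: "ends_within (Suc (cost body_peel) * (card (edges F) + n) + 1) (WhileNz 6 body_peel) s
      (\<lambda>s. fst s 6 = 0 \<and> (\<exists>m. inv_peel m s))" if "inv_peel (card (edges F) + n) s" for s
    using ends_within_While[OF lf(3) that inv_peel_step] .
  have w4: "ends_within (Suc (cost body_count) * n + 1) (WhileNz 6 body_count) s
      (\<lambda>s. fst s 6 = 0 \<and> (\<exists>m. inv_count m s))" if "inv_count n s" for s
    using ends_within_While[OF lf(4) that inv_count_step] .
  note b = ends_within_loop_free
  define t where "t = cost prog_init + (Suc (cost body_length) * n + 1 + (cost prog_read_init +
      (Suc (cost body_read) * (B - 2) + 1 + (cost prog_peel_init +
      (Suc (cost body_peel) * (card (edges F) + n) + 1 + (cost prog_count_init +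
      (Suc (cost body_count) * n + 1 + cost prog_answer)))))))"
  have "ends_within t prog (ram_init xs)
      (\<lambda>s. fst s 0 = (if linear_forest_deletion_yes (F, k) then 1 else 0))"
    unfolding prog_def t_def
    apply (rule ends_within_Seq[OF b[OF lf(5), of "inv_length n"]], rule inv_length_init)
    apply (rule ends_within_Seq[OF w1], assumption)
    apply (rule ends_within_Seq[OF b[OF lf(6), of "inv_read (B - 2)"]], use inv_read_init in blast)
    apply (rule ends_within_Seq[OF w2], assumption)
    apply (rule ends_within_Seq[OF b[OF lf(7), of "inv_peel (card (edges F) + n)"]], use inv_peel_init in blast)
    apply (rule ends_within_Seq[OF w3], assumption)
    apply (rule ends_within_Seq[OF b[OF lf(8), of "inv_count n"]], use inv_count_init in blast)
    apply (rule ends_within_Seq[OF w4], assumption)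
    apply (rule b[OF lf(9)], use inv_count_answer in blast)
    done
  then show ?thesis
  proof (rule ends_within_mono)
    \<comment> \<open>Five straight-line blocks of cost at most 50 and four loops of cost at most
      \<open>50 * B + 1\<close> take at most \<open>254 + 200 * B\<close> steps, well within the
      claimed bound.\<close>
    have bound: "a + (x + 1 + (b + (y + 1 + (c + (z + 1 + (d + (w + 1 + e))))))) \<le> 1000 * (B + 1)"
      if "a \<le> 50" "b \<le> 50" "c \<le> 50" "d \<le> 50" "e \<le> 50"
        "x \<le> 50 * B" "y \<le> 50 * B" "z \<le> 50 * B" "w \<le> 50 * B" for a b c d e x y z w
      using that by simp
    have "cost prog_init \<le> 50" "cost prog_read_init \<le> 50" "cost prog_peel_init \<le> 50"
      "cost prog_count_init \<le> 50" "cost prog_answer \<le> 50"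
      by (simp_all add: prog_defs)
    moreover have "Suc (cost body_length) * n \<le> 50 * B" "Suc (cost body_read) * (B - 2) \<le> 50 * B"
      "Suc (cost body_peel) * (card (edges F) + n) \<le> 50 * B" "Suc (cost body_count) * n \<le> 50 * B"
      using card_edges_le by (intro mult_le_mono; simp add: prog_defs)+
    ultimately show "t \<le> 1000 * (B + 1)" unfolding t_def by (rule bound)
  qed
qed

end

lemma linear_forest_deletion_linear_time:
  "linear_time_decidable adj_list_encoding linear_forest_deletion_instance linear_forest_deletion_yes"
  unfolding linear_time_decidable_def
proof (rule exI[of _ prog], rule exI[of _ 1000], intro allI impI)
  fix x :: "nat graph \<times> nat" and xs
  assume "linear_forest_deletion_instance x" "adj_list_encoding xs x"
  moreover obtain F k where x: "x = (F, k)" by (cases x)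
  ultimately obtain adj where "forest F" "verts F = {..<length adj}"
    "\<forall>i<length adj. distinct (adj ! i) \<and> set (adj ! i) = {j. {i, j} \<in> edges F}"
    "xs = length adj # k # concat (map (\<lambda>ns. length ns # ns) adj)"
    by (auto simp: linear_forest_deletion_instance_def adj_list_encoding_def)
  then interpret encoded_forest F k adj xs
    by unfold_locales (auto simp: nbrs_def)
  show "\<exists>t R M. ram_exec prog (ram_init xs) t (R, M) \<and> t \<le> 1000 * (length xs + 1) \<and>
     R 0 = (if linear_forest_deletion_yes x then 1 else 0)"
    using prog_correct unfolding ends_within_def x by auto
qed

theorem theorem3:
  shows "(\<forall>(T :: 'a graph) r v p S.
      rooted_tree T r \<longrightarrow> v \<in> verts T \<longrightarrow> p = parent T r v \<longrightarrow>
      S = claw_deletion_set_proc T r v p \<longrightarrow>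
        min_claw_deletion_set (subtree_plus T r v) S \<and>
        (cdn (subtree_plus T r v) = 1 + cdn (subtree T r v) \<longrightarrow> p \<in> Some ` S) \<and>
        (cdn (subtree_plus T r v) = cdn (subtree T r v) \<and>
         cdn (subtree T r v) = 1 + cdn (delete_verts (subtree T r v) {v}) \<longrightarrow> v \<in> S))
    \<and> linear_time_decidable adj_list_encoding
        linear_forest_deletion_instance linear_forest_deletion_yes"
proof (intro conjI[OF _ linear_forest_deletion_linear_time] allI impI)
  fix T :: "'a graph" and r v p S
  assume *: "rooted_tree T r" "v \<in> verts T" "p = parent T r v" "S = claw_deletion_set_proc T r v p"
  note c = claw_deletion_set_proc_correct[OF *]
  show "min_claw_deletion_set (subtree_plus T r v) S \<and>
    (cdn (subtree_plus T r v) = 1 + cdn (subtree T r v) \<longrightarrow> p \<in> Some ` S) \<and>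
    (cdn (subtree_plus T r v) = cdn (subtree T r v) \<and>
     cdn (subtree T r v) = 1 + cdn (delete_verts (subtree T r v) {v}) \<longrightarrow> v \<in> S)"
    using c(1) c(2) c(3) by blast
qed

end
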